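(* Let $\boldsymbol{\delta},\boldsymbol{\delta}'\in\mathbb{R}^{np}$, $\mathbf{\Omega}=\mathbf{V}\otimes\boldsymbol{\Sigma}$, $\mathbf{\Omega}'=\mathbf{V}'\otimes\boldsymbol{\Sigma}'$, with $\mathbf{V},\mathbf{V}'$ ($p\times p$) and $\boldsymbol{\Sigma},\boldsymbol{\Sigma}'$ ($n\times n$) positive definite, and let $\overline{\mathbf{\Omega}},\overline{\mathbf{\Omega}'}$ be the correlation matrices associated with $\mathbf{\Omega},\mathbf{\Omega}'$. Let $\boldsymbol{X}_0\sim SN_{n\times p}(\boldsymbol{0}_{n\times p},\overline{\mathbf{\Omega}},*,\boldsymbol{\delta})$ and $\boldsymbol{Y}_0\sim SN_{n\times p}(\boldsymbol{0}_{n\times p},\overline{\mathbf{\Omega}'},*,\boldsymbol{\delta}')$. Then $\boldsymbol{X}_0\le_{dcx}\boldsymbol{Y}_0$ if and only if $\boldsymbol{\delta}=\boldsymbol{\delta}'$ and $\overline{\mathbf{\Omega}'}-\overline{\mathbf{\Omega}}\ge\boldsymbol{0}$ (entrywise).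
   Context: Notation: $\mathrm{vec}$ stacks the columns of a matrix into one column vector, $\otimes$ is the Kronecker product; inequalities between vectors or matrices are entrywise. Multivariate skew-normal: for a positive definite $m\times m$ matrix $\mathbf{\Omega}=(\omega_{ij})$ put $\boldsymbol{\omega}=\mathrm{diag}\{\sqrt{\omega_{11}},\dots,\sqrt{\omega_{mm}}\}$ and let $\overline{\mathbf{\Omega}}=\boldsymbol{\omega}^{-1}\mathbf{\Omega}\boldsymbol{\omega}^{-1}$ be the associated correlation matrix. For $\boldsymbol{\mu},\boldsymbol{\alpha}\in\mathbb{R}^m$, $SN_m(\boldsymbol{\mu},\mathbf{\Omega},\boldsymbol{\alpha})$ is the distribution with density $2\phi_m(\boldsymbol{z};\boldsymbol{\mu},\mathbf{\Omega})\Phi(\boldsymbol{\alpha}^T\boldsymbol{\omega}^{-1}(\boldsymbol{z}-\boldsymbol{\mu}))$, where $\phi_m(\cdot;\boldsymbol{\mu},\mathbf{\Omega})$ is the $N_m(\boldsymbol{\mu},\mathbf{\Omega})$ density and $\Phi$ the standard normal distribution function. Its parameter $\boldsymbol{\delta}$ is $\boldsymbol{\delta}=(1+\boldsymbol{\alpha}^T\overline{\mathbf{\Omega}}\boldsymbol{\alpha})^{-1/2}\boldsymbol{\omega}\overline{\mathbf{\Omega}}\boldsymbol{\alpha}$; it satisfies $\boldsymbol{\delta}^T\mathbf{\Omega}^{-1}\boldsymbol{\delta}<1$ and determines $\boldsymbol{\alpha}=(1-\boldsymbol{\delta}^T\mathbf{\Omega}^{-1}\boldsymbol{\delta})^{-1/2}\boldsymbol{\omega}\mathbf{\Omega}^{-1}\boldsymbol{\delta}$.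 One writes $SN_m(\boldsymbol{\mu},\mathbf{\Omega},\boldsymbol{\alpha},\boldsymbol{\delta})$, with $*$ in place of $\boldsymbol{\alpha}$ or $\boldsymbol{\delta}$ when it is not displayed. Matrix variate skew-normal: an $n\times p$ random matrix satisfies $\boldsymbol{Z}\sim SN_{n\times p}(\mathbf{M},\mathbf{\Omega},\mathbf{B},\boldsymbol{\delta})$ iff $\mathrm{vec}(\boldsymbol{Z})\sim SN_{np}(\mathrm{vec}(\mathbf{M}),\mathbf{\Omega},\mathrm{vec}(\mathbf{B}),\boldsymbol{\delta})$; $*$ in place of $\mathbf{B}$ means it is the skewness parameter determined by $\boldsymbol{\delta}$ and the scale matrix (writing such a distribution presupposes that $\boldsymbol{\delta}$ is admissible for the scale matrix, i.e. the quadratic form of $\boldsymbol{\delta}$ in the inverse scale matrix is $<1$). Directionally convex order: for $f:\mathbb{R}^{n\times p}\to\mathbb{R}$ and $\epsilon>0$ put $\Delta_{i,j}^{\epsilon}f(\mathbf{X})=f(\mathbf{X}+\epsilon\mathbf{E}_{i,j})-f(\mathbf{X})$, where $\mathbf{E}_{i,j}$ is the $(i,j)$-th unit basis matrix of $\mathbb{R}^{n\times p}$. The function $f$ is directionally convex if $\Delta_{k,i}^{\epsilon}\Delta_{l,j}^{\eta}f(\mathbf{X})\ge0$ for all $\mathbf{X}\in\mathbb{R}^{n\times p}$, $k,l\in\{1,\dots,n\}$, $i,j\in\{1,\dots,p\}$ and $\epsilon,\eta>0$. $\boldsymbol{X}\le_{dcx}\boldsymbol{Y}$ means $Ef(\boldsymbol{X})\le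 Ef(\boldsymbol{Y})$ for all directionally convex measurable functions $f$ for which the expectations are well defined. *)

theory Defs
  imports "HOL-Probability.Probability"
begin

definition pos_def :: "real^'m^'m \<Rightarrow> bool" where
  "pos_def A \<longleftrightarrow> transpose A = A \<and> (\<forall>x. x \<noteq> 0 \<longrightarrow> x \<bullet> (A *v x) > 0)"

text \<open>
  Vectors in \<open>\<real>\<^sup>n\<^sup>p\<close> are indexed by pairs \<open>(j, i)\<close> of a column index \<open>j\<close> and a row index \<open>i\<close>;
  the lexicographic order of these pairs is the order in which the entries appear when the
  columns are stacked, and it is also the block order of the Kronecker product.
\<close>

definition vec_stack :: "real^'p^'n \<Rightarrow> real^('p \<times> 'n)" where
  "vec_stack A = (\<chi> k. A $ snd k $ fst k)"

definition kronecker :: "real^'p^'p \<Rightarrow> real^'n^'n \<Rightarrow> real^('p \<times> 'n)^('p \<times> 'n)" where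
  "kronecker A B = (\<chi> k l. A $ fst k $ fst l * B $ snd k $ snd l)"

definition scale_diag :: "real^'m^'m \<Rightarrow> real^'m^'m" where
  "scale_diag \<Omega> = (\<chi> i j. if i = j then sqrt (\<Omega> $ i $ i) else 0)"

definition corr_matrix :: "real^'m^'m \<Rightarrow> real^'m^'m" where
  "corr_matrix \<Omega> = matrix_inv (scale_diag \<Omega>) ** \<Omega> ** matrix_inv (scale_diag \<Omega>)"

definition mvn_density :: "real^'m \<Rightarrow> real^'m^'m \<Rightarrow> real^'m \<Rightarrow> real" where
  "mvn_density \<mu> \<Omega> z =
     (2 * pi) powr (- real CARD('m) / 2) * det \<Omega> powr (- 1 / 2)
       * exp (- ((z - \<mu>) \<bullet> (matrix_inv \<Omega> *v (z - \<mu>))) / 2)"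

definition sn_density :: "real^'m \<Rightarrow> real^'m^'m \<Rightarrow> real^'m \<Rightarrow> real^'m \<Rightarrow> real" where
  "sn_density \<mu> \<Omega> \<alpha> z =
     2 * mvn_density \<mu> \<Omega> z
       * cdf std_normal_distribution (\<alpha> \<bullet> (matrix_inv (scale_diag \<Omega>) *v (z - \<mu>)))"

definition sn_delta :: "real^'m^'m \<Rightarrow> real^'m \<Rightarrow> real^'m" where
  "sn_delta \<Omega> \<alpha> =
     (1 + \<alpha> \<bullet> (corr_matrix \<Omega> *v \<alpha>)) powr (- 1 / 2)
       *\<^sub>R (scale_diag \<Omega> *v (corr_matrix \<Omega> *v \<alpha>))"

definition sn_admissible :: "real^'m^'m \<Rightarrow> real^'m \<Rightarrow> bool" where
  "sn_admissible \<Omega> \<delta> \<longleftrightarrow> \<delta> \<bullet> (matrix_inv \<Omega> *v \<delta>) < 1"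

definition sn_alpha :: "real^'m^'m \<Rightarrow> real^'m \<Rightarrow> real^'m" where
  "sn_alpha \<Omega> \<delta> =
     (1 - \<delta> \<bullet> (matrix_inv \<Omega> *v \<delta>)) powr (- 1 / 2)
       *\<^sub>R (scale_diag \<Omega> *v (matrix_inv \<Omega> *v \<delta>))"

definition skew_normal ::
  "'a measure \<Rightarrow> ('a \<Rightarrow> real^'m) \<Rightarrow> real^'m \<Rightarrow> real^'m^'m \<Rightarrow> real^'m \<Rightarrow> real^'m \<Rightarrow> bool" where
  "skew_normal M Z \<mu> \<Omega> \<alpha> \<delta> \<longleftrightarrow>
     pos_def \<Omega> \<and> \<delta> = sn_delta \<Omega> \<alpha> \<and>
     distributed M lborel Z (\<lambda>z. ennreal (sn_density \<mu> \<Omega> \<alpha> z))"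

definition matrix_skew_normal ::
  "'a measure \<Rightarrow> ('a \<Rightarrow> real^'p^'n) \<Rightarrow> real^'p^'n \<Rightarrow> real^('p \<times> 'n)^('p \<times> 'n)
     \<Rightarrow> real^'p^'n \<Rightarrow> real^('p \<times> 'n) \<Rightarrow> bool" where
  "matrix_skew_normal M Z Mu \<Omega> B \<delta> \<longleftrightarrow>
     skew_normal M (\<lambda>x. vec_stack (Z x)) (vec_stack Mu) \<Omega> (vec_stack B) \<delta>"

text \<open>The version with \<open>*\<close> in place of the skewness matrix \<open>B\<close>.\<close>

definition matrix_skew_normal_star ::
  "'a measure \<Rightarrow> ('a \<Rightarrow> real^'p^'n) \<Rightarrow> real^'p^'n \<Rightarrow> real^('p \<times> 'n)^('p \<times> 'n)
     \<Rightarrow> real^('p \<times> 'n) \<Rightarrow> bool" where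
  "matrix_skew_normal_star M Z Mu \<Omega> \<delta> \<longleftrightarrow>
     sn_admissible \<Omega> \<delta> \<and>
     (\<exists>B. vec_stack B = sn_alpha \<Omega> \<delta> \<and> matrix_skew_normal M Z Mu \<Omega> B \<delta>)"

definition unit_matrix :: "'n \<Rightarrow> 'p \<Rightarrow> real^'p^'n" where
  "unit_matrix i j = axis i (axis j 1)"

definition diff_op ::
  "'n \<Rightarrow> 'p \<Rightarrow> real \<Rightarrow> (real^'p^'n \<Rightarrow> real) \<Rightarrow> real^'p^'n \<Rightarrow> real" where
  "diff_op i j \<epsilon> f X = f (X + \<epsilon> *\<^sub>R unit_matrix i j) - f X"

definition directionally_convex :: "(real^'p^'n \<Rightarrow> real) \<Rightarrow> bool" where
  "directionally_convex f \<longleftrightarrow>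
     (\<forall>X k l i j \<epsilon> \<eta>. \<epsilon> > 0 \<and> \<eta> > 0 \<longrightarrow> diff_op k i \<epsilon> (diff_op l j \<eta> f) X \<ge> 0)"

text \<open>
  The two random matrices may live on different probability spaces.  The expectations being
  well defined is read as integrability, i.e. existence of both as real numbers.
\<close>

definition dcx_le ::
  "'a measure \<Rightarrow> ('a \<Rightarrow> real^'p^'n) \<Rightarrow> 'b measure \<Rightarrow> ('b \<Rightarrow> real^'p^'n) \<Rightarrow> bool" where
  "dcx_le M X N Y \<longleftrightarrow>
     (\<forall>f. directionally_convex f \<and> f \<in> borel_measurable borel
          \<and> integrable M (\<lambda>x. f (X x)) \<and> integrable N (\<lambda>y. f (Y y))
        \<longrightarrow> (LINT x|M. f (X x)) \<le> (LINT y|N. f (Y y)))"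

end

theory Submission
  imports Defs
begin

text \<open>
  A skew-normal vector is \<open>Z = |U| \<delta> + W\<close> with \<open>U\<close> standard normal and \<open>W\<close> an independent centred
  normal vector of covariance \<open>S = \<Omega> - \<delta> \<delta>\<^sup>T\<close>. Hence \<open>E Z = \<delta> / sqrt (pi / 2)\<close> and
  \<open>E Z\<^sub>i Z\<^sub>j = \<Omega>\<^sub>i\<^sub>j\<close>, so the test functions \<open>\<plusminus> x\<^sub>i\<close> and \<open>x\<^sub>i x\<^sub>j\<close> give necessity. For sufficiency,
  condition on \<open>U\<close>; it remains to compare centred normal laws with covariances \<open>S \<le> T\<close> (entrywise).
  Along \<open>S + r (T - S)\<close> the normal density satisfies the heat equation
  \<open>\<partial>\<^sub>r \<phi> = 1/2 \<Sum> (T - S)\<^sub>i\<^sub>j \<partial>\<^sub>i \<partial>\<^sub>j \<phi>\<close>, and \<open>\<integral> f \<partial>\<^sub>i \<partial>\<^sub>j \<phi> \<ge> 0\<close> for directionally convex \<open>f\<close>.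

  The test functions are only known to be integrable at the two endpoints, so their growth must be
  controlled for the intermediate covariances. Integrability against the law with covariance \<open>T\<close>
  bounds \<open>f x\<close> by about \<open>exp (x\<^sup>T T\<inverse> x / 2)\<close>. If \<open>A \<le> T\<close> entrywise, every \<open>x\<close> lies in an order
  interval \<open>[u, v]\<close> whose corners satisfy \<open>u\<^sup>T T\<inverse> u, v\<^sup>T T\<inverse> v \<le> x\<^sup>T A\<inverse> x\<close>, and directional convexity
  bounds \<open>f x\<close> by the values of \<open>f\<close> near \<open>u\<close> and \<open>v\<close>.
\<close>

section \<open>Positive definite matrices and directional convexity\<close>

text \<open>Admissibility of \<delta> is what makes S positive definite. Once \<delta> = \<delta>',
  the two mixtures share the weight of |U| and the shift |U| \<delta>, so T - S is the difference of
  the two correlation matrices. Their unit diagonal makes \<open>scale_diag\<close> the identity, so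
  the skewness parameter is a multiple of \<Omega>^{-1} \<delta>, as completing the square in u
  requires. Normal means are treated as quotients h(r) / Z(r) of unnormalised integrals.
  Differentiating the exponential alone leaves out the trace term that the determinant would
  contribute; the second derivative inequality for f, 1 and -1 gives h' >= t h and Z' = t Z with the
  same t, so the quotient increases and no determinant is evaluated. Growth bounds have to be
  two-sided. The inequality on an order interval bounds only the sum of f at a point and at its
  mirror image, so a separate lower bound is obtained by extrapolating from the lower corner. Every
  passage costs a little in the exponential rate, which is why strict gaps between rates occur
  throughout.\<close>

lemma pos_def_inner:
  fixes A :: "real^'m^'m"
  assumes "pos_def A"
  shows "(A *v x) \<bullet> y = x \<bullet> (A *v y)"
  using assms unfolding pos_def_def by (metis dot_lmul_matrix vector_transpose_matrix)

lemma pos_def_pos: "pos_def A \<Longrightarrow> x \<noteq> 0 \<Longrightarrow> 0 < x \<bullet> (A *v x)"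
  unfolding pos_def_def by blast

lemma pos_def_nonneg: "pos_def A \<Longrightarrow> 0 \<le> x \<bullet> (A *v x)"
  using pos_def_pos[of A x] by (cases "x = 0") auto

lemma pos_defI:
  fixes A :: "real^'m^'m"
  assumes "\<And>x y. (A *v x) \<bullet> y = x \<bullet> (A *v y)" "\<And>x. x \<noteq> 0 \<Longrightarrow> 0 < x \<bullet> (A *v x)"
  shows "pos_def A"
proof -
  have "transpose A *v y = A *v y" for y
    by (rule vector_eq_rdot[THEN iffD1])
      (metis assms(1) dot_lmul_matrix inner_commute transpose_matrix_vector)
  then have "transpose A = A"
    by (simp add: matrix_eq)
  then show ?thesis
    using assms(2) by (simp add: pos_def_def)
qed

lemma pos_def_entry_sym: "pos_def A \<Longrightarrow> A $ i $ j = A $ j $ i"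
  unfolding pos_def_def by (metis transpose_def vec_lambda_beta)

lemma pos_def_inverse:
  fixes A :: "real^'m^'m"
  assumes "pos_def A"
  shows "A ** matrix_inv A = mat 1" "matrix_inv A ** A = mat 1"
proof -
  have "A *v x = 0 \<Longrightarrow> x = 0" for x
    using pos_def_pos[OF assms, of x] by force
  then have "invertible A"
    by (metis invertible_left_inverse matrix_left_invertible_ker)
  then show "A ** matrix_inv A = mat 1" "matrix_inv A ** A = mat 1"
    using someI_ex[of "\<lambda>A'. A ** A' = mat 1 \<and> A' ** A = mat 1"]
    unfolding invertible_def matrix_inv_def by blast+
qed

lemma pos_def_inverse_vector:
  fixes A :: "real^'m^'m"
  assumes "pos_def A"
  shows "A *v (matrix_inv A *v x) = x" "matrix_inv A *v (A *v x) = x"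
  by (simp_all add: matrix_vector_mul_assoc pos_def_inverse[OF assms])

lemma matrix_inv_unique:
  fixes A B :: "real^'m^'m"
  assumes "A ** B = mat 1"
  shows "matrix_inv A = B"
proof -
  have "B ** A = mat 1" using assms matrix_left_right_inverse by blast
  then have "\<exists>A'. A ** A' = mat 1 \<and> A' ** A = mat 1"
    using assms by blast
  then have *: "A ** matrix_inv A = mat 1 \<and> matrix_inv A ** A = mat 1"
    unfolding matrix_inv_def by (rule someI_ex)
  have "matrix_inv A = (B ** A) ** matrix_inv A"
    using \<open>B ** A = mat 1\<close> by simp
  also have "\<dots> = B"
    using * by (simp add: matrix_mul_assoc[symmetric])
  finally show ?thesis .
qed

lemma pos_def_matrix_inv:
  fixes A :: "real^'m^'m"
  assumes "pos_def A"
  shows "pos_def (matrix_inv A)"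
proof (rule pos_defI)
  fix x y :: "real^'m"
  let ?B = "matrix_inv A"
  have "(?B *v x) \<bullet> y = (?B *v x) \<bullet> (A *v (?B *v y))"
    by (simp add: pos_def_inverse_vector[OF assms])
  also have "\<dots> = x \<bullet> (?B *v y)"
    using pos_def_inner[OF assms, of "?B *v x"] by (simp add: pos_def_inverse_vector[OF assms])
  finally show "(?B *v x) \<bullet> y = x \<bullet> (?B *v y)" .
next
  fix x :: "real^'m"
  let ?B = "matrix_inv A"
  assume "x \<noteq> 0"
  then have "?B *v x \<noteq> 0"
    using pos_def_inverse_vector(1)[OF assms, of x] by force
  then have "0 < (?B *v x) \<bullet> (A *v (?B *v x))"
    by (rule pos_def_pos[OF assms])
  then show "0 < x \<bullet> (?B *v x)"
    by (simp add: pos_def_inverse_vector[OF assms] inner_commute)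
qed

lemma quad_form_add:
  fixes A :: "real^'m^'m"
  assumes "pos_def A"
  shows "(x + y) \<bullet> (A *v (x + y)) = x \<bullet> (A *v x) + 2 * (x \<bullet> (A *v y)) + y \<bullet> (A *v y)"
  using pos_def_inner[OF assms, of y x]
  by (simp add: matrix_vector_right_distrib inner_add_left inner_add_right inner_commute)

lemma quad_form_diff:
  fixes A :: "real^'m^'m"
  assumes "pos_def A"
  shows "(x - y) \<bullet> (A *v (x - y)) = x \<bullet> (A *v x) - 2 * (x \<bullet> (A *v y)) + y \<bullet> (A *v y)"
  using pos_def_inner[OF assms, of y x]
  by (simp add: matrix_vector_mult_diff_distrib inner_diff_left inner_diff_right inner_commute)

lemma pos_def_cauchy:
  fixes A :: "real^'m^'m"
  assumes "pos_def A"
  shows "(x \<bullet> (A *v y))\<^sup>2 \<le> (x \<bullet> (A *v x)) * (y \<bullet> (A *v y))"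
proof (cases "y = 0")
  case False
  let ?a = "y \<bullet> (A *v y)" and ?b = "x \<bullet> (A *v y)" and ?c = "x \<bullet> (A *v x)"
  \<comment> \<open>This vector is \<open>?a\<close> times the component of x orthogonal to y with
    respect to A, which avoids a division.\<close>
  have "0 \<le> (?a *\<^sub>R x - ?b *\<^sub>R y) \<bullet> (A *v (?a *\<^sub>R x - ?b *\<^sub>R y))"
    by (rule pos_def_nonneg[OF assms])
  also have "\<dots> = ?a * (?c * ?a - ?b\<^sup>2)"
    unfolding quad_form_diff[OF assms]
    by (simp add: matrix_vector_mult_scaleR power2_eq_square algebra_simps)
  finally show ?thesis
    using pos_def_pos[OF assms False] by (simp add: zero_le_mult_iff)
qed simp

text \<open>Cauchy-Schwarz for A at the pair A^{-1} x, y. It links the quadratic form of a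
  covariance to that of its precision matrix.\<close>

lemma pos_def_cauchy_dual:
  fixes A :: "real^'m^'m"
  assumes "pos_def A"
  shows "(x \<bullet> y)\<^sup>2 \<le> (x \<bullet> (matrix_inv A *v x)) * (y \<bullet> (A *v y))"
  using pos_def_cauchy[OF assms, of "matrix_inv A *v x" y]
    pos_def_inner[OF assms, of "matrix_inv A *v x" y]
  by (simp add: pos_def_inverse_vector[OF assms] inner_commute)

lemma quad_form_lower:
  fixes A :: "real^'m^'m"
  assumes "pos_def A"
  obtains c where "c > 0" "\<And>x. c * (norm x)\<^sup>2 \<le> x \<bullet> (A *v x)"
proof -
  have "continuous_on (sphere 0 1) (\<lambda>x::real^'m. x \<bullet> (A *v x))"
    by (intro continuous_intros linear_continuous_on matrix_vector_mul_bounded_linear)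
  then obtain u :: "real^'m" where u: "norm u = 1" "\<And>x. norm x = 1 \<Longrightarrow> u \<bullet> (A *v u) \<le> x \<bullet> (A *v x)"
    using continuous_attains_inf[of "sphere (0::real^'m) 1"] by force
  show ?thesis
  proof
    show "0 < u \<bullet> (A *v u)"
      using u(1) by (intro pos_def_pos[OF assms]) auto
    show "(u \<bullet> (A *v u)) * (norm x)\<^sup>2 \<le> x \<bullet> (A *v x)" for x
    proof (cases "x = 0")
      case False
      have "u \<bullet> (A *v u) \<le> (x /\<^sub>R norm x) \<bullet> (A *v (x /\<^sub>R norm x))"
        using False by (intro u(2)) simp
      also have "\<dots> = (x \<bullet> (A *v x)) / (norm x)\<^sup>2"
        by (simp add: matrix_vector_mult_scaleR power2_eq_square field_simps)
      finally show ?thesis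
        using False by (simp add: field_simps)
    qed simp
  qed
qed

lemma quad_form_upper:
  fixes A :: "real^'m^'m"
  obtains C where "C > 0" "\<And>x. x \<bullet> (A *v x) \<le> C * (norm x)\<^sup>2"
proof -
  obtain B where B: "B > 0" "\<And>x. norm (A *v x) \<le> B * norm x"
    using linear_bounded_pos[OF matrix_vector_mul_linear[of A]] by blast
  have "x \<bullet> (A *v x) \<le> B * (norm x)\<^sup>2" for x
    using norm_cauchy_schwarz[of x "A *v x"] mult_left_mono[OF B(2) norm_ge_zero, of x x]
    by (simp add: power2_eq_square algebra_simps)
  with B(1) that show thesis by blast
qed

text \<open>Young's inequality with weight e, read off from the form at
  \<open>e *\<^sub>R x - d\<close>. The factor at x can be brought as close to 1 as desired, the
  only kind of loss the exponents below can afford.\<close>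

lemma quad_form_perturb:
  fixes A :: "real^'m^'m"
  assumes "pos_def A" "e > 0"
  shows "(x + d) \<bullet> (A *v (x + d)) \<le> (1 + e) * (x \<bullet> (A *v x)) + (1 + 1 / e) * (d \<bullet> (A *v d))"
proof -
  have "0 \<le> (e *\<^sub>R x - d) \<bullet> (A *v (e *\<^sub>R x - d))"
    by (rule pos_def_nonneg[OF assms(1)])
  also have "\<dots> = e * (e * (x \<bullet> (A *v x)) - 2 * (x \<bullet> (A *v d)) + (d \<bullet> (A *v d)) / e)"
    unfolding quad_form_diff[OF assms(1)] using assms(2)
    by (simp add: matrix_vector_mult_scaleR power2_eq_square algebra_simps)
  finally have "2 * (x \<bullet> (A *v d)) \<le> e * (x \<bullet> (A *v x)) + (d \<bullet> (A *v d)) / e"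
    using assms(2) by (simp add: zero_le_mult_iff)
  then show ?thesis
    unfolding quad_form_add[OF assms(1)] by (simp add: algebra_simps)
qed

lemma pos_def_add:
  fixes A B :: "real^'m^'m"
  shows "pos_def A \<Longrightarrow> pos_def B \<Longrightarrow> pos_def (A + B)"
  by (rule pos_defI)
    (simp_all add: matrix_vector_mult_add_rdistrib inner_add_left inner_add_right pos_def_inner
      add_pos_pos pos_def_pos)

lemma pos_def_scaleR:
  fixes A :: "real^'m^'m"
  shows "pos_def A \<Longrightarrow> 0 < c \<Longrightarrow> pos_def (c *\<^sub>R A)"
  by (rule pos_defI)
    (simp_all add: scaleR_matrix_vector_assoc[symmetric] pos_def_inner pos_def_pos)

section \<open>Increments of directionally convex functions\<close>

text \<open>The coordinate-free form of directional convexity.\<close>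

definition dcx_fun :: "(real^'m \<Rightarrow> real) \<Rightarrow> bool" where
  "dcx_fun f \<longleftrightarrow> (\<forall>x h k. 0 \<le> h \<longrightarrow> 0 \<le> k \<longrightarrow> f (x + h) + f (x + k) \<le> f (x + h + k) + f x)"

lemma dcx_funD:
  "dcx_fun f \<Longrightarrow> 0 \<le> h \<Longrightarrow> 0 \<le> k \<Longrightarrow> f (x + h) + f (x + k) \<le> f (x + h + k) + f x"
  unfolding dcx_fun_def by blast

text \<open>Reduces nonnegative increments to the positive coordinate steps of the definition;
  vanishing coordinates fall under the zero case.\<close>

lemma nonneg_vec_induct [consumes 1, case_names zero add axis]:
  fixes h :: "real^'m"
  assumes "0 \<le> h" "P 0" "\<And>a b. P a \<Longrightarrow> P b \<Longrightarrow> P (a + b)" "\<And>i e. 0 < e \<Longrightarrow> P (axis i e)"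
  shows "P h"
proof -
  have nn: "0 \<le> h $ i" for i
    using assms(1) by (simp add: less_eq_vec_def)
  have ax: "P (axis i (h $ i))" for i
  proof (cases "h $ i = 0")
    case True
    have "axis i 0 = (0::real^'m)"
      by (simp add: axis_def vec_eq_iff)
    with True assms(2) show ?thesis by metis
  qed (use nn[of i] assms(4) in simp)
  have "finite I \<Longrightarrow> P (\<Sum>i\<in>I. axis i (h $ i))" for I
    by (induction I rule: finite_induct) (auto simp: assms ax)
  moreover have "(\<Sum>i\<in>UNIV. axis i (h $ i)) = h"
    by (simp add: vec_eq_iff axis_def)
  ultimately show ?thesis
    using finite[of "UNIV::'m set"] by metis
qed

text \<open>The mixed second difference is additive in each increment: for \<open>a + b\<close> at x
  it is the one for a at x plus the one for b at \<open>x + a\<close>. Nonnegativity therefore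
  spreads from coordinate steps first to k, then to h.\<close>

lemma dcx_funI:
  fixes f :: "real^'m \<Rightarrow> real"
  assumes "\<And>x i j e d. 0 < e \<Longrightarrow> 0 < d \<Longrightarrow>
    f (x + axis i e) + f (x + axis j d) \<le> f (x + axis i e + axis j d) + f x"
  shows "dcx_fun f"
proof -
  have 1: "\<forall>x i e. 0 < e \<longrightarrow> f (x + axis i e) + f (x + k) \<le> f (x + axis i e + k) + f x"
    if "0 \<le> k" for k
    using that
  proof (induction k rule: nonneg_vec_induct)
    case (add a b)
    show ?case
    proof (intro allI impI)
      fix x i and e :: real
      assume "e > 0"
      then show "f (x + axis i e) + f (x + (a + b)) \<le> f (x + axis i e + (a + b)) + f x"
        using add(1)[rule_format, of e x i] add(2)[rule_format, of e "x + a" i] by (simp add: ac_simps)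
    qed
  qed (use assms in auto)
  have 2: "\<forall>x k. 0 \<le> k \<longrightarrow> f (x + h) + f (x + k) \<le> f (x + h + k) + f x" if "0 \<le> h" for h
    using that
  proof (induction h rule: nonneg_vec_induct)
    case (add a b)
    show ?case
    proof (intro allI impI)
      fix x k :: "real^'m"
      assume "0 \<le> k"
      then show "f (x + (a + b)) + f (x + k) \<le> f (x + (a + b) + k) + f x"
        using add(1)[rule_format, of k x] add(2)[rule_format, of k "x + a"] by (simp add: ac_simps)
    qed
  qed (use 1 in auto)
  then show ?thesis
    unfolding dcx_fun_def by blast
qed

text \<open>With increments \<open>x - u\<close> and \<open>v - x\<close> from u, the intermediate
  corners are x and its mirror image. An upper bound at x thus requires a lower bound at
  \<open>u + v - x\<close>.\<close>

lemma dcx_fun_box: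
  fixes f :: "real^'m \<Rightarrow> real"
  assumes "dcx_fun f" "u \<le> x" "x \<le> v"
  shows "f x + f (u + v - x) \<le> f u + f v"
proof -
  have "f (u + (x - u)) + f (u + (v - x)) \<le> f (u + (x - u) + (v - x)) + f u"
    using assms by (intro dcx_funD) auto
  then show ?thesis by (simp add: algebra_simps)
qed

text \<open>Increments along a nonnegative direction do not decrease, so n steps forward gain at
  least n times the last step before u. This gives lower bounds from values near u alone.\<close>

lemma dcx_fun_extrapolate:
  fixes f :: "real^'m \<Rightarrow> real"
  assumes "dcx_fun f" "0 \<le> h"
  shows "real n * (f u - f (u - h)) \<le> f (u + real n *\<^sub>R h) - f u"
proof (induction n)
  case (Suc n)
  have "0 \<le> real (Suc n) *\<^sub>R h"
    using assms(2) by (simp add: less_eq_vec_def)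
  then have "f (u - h + h) + f (u - h + real (Suc n) *\<^sub>R h) \<le> f (u - h + h + real (Suc n) *\<^sub>R h) + f (u - h)"
    using assms by (intro dcx_funD) auto
  then have "f u + f (u + real n *\<^sub>R h) \<le> f (u + real (Suc n) *\<^sub>R h) + f (u - h)"
    by (simp add: algebra_simps)
  with Suc show ?case by (simp add: algebra_simps)
qed simp

text \<open>Here x is an intermediate corner of a parallelogram, in the companion for
  \<open>f x \<le> 0\<close> its top corner. Either way h and k stay free to be averaged over full
  cubes.\<close>

lemma dcx_fun_abs_upper:
  fixes f :: "real^'m \<Rightarrow> real"
  assumes "dcx_fun f" "0 \<le> f x" "0 \<le> h" "k \<le> 0"
  shows "\<bar>f x\<bar> \<le> \<bar>f (x + h)\<bar> + \<bar>f (x + k)\<bar> + \<bar>f (x + h + k)\<bar>"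
proof -
  have "f (x + k + h) + f (x + k + (- k)) \<le> f (x + k + h + (- k)) + f (x + k)"
    using assms(3,4) by (intro dcx_funD[OF assms(1)]) (auto simp: less_eq_vec_def)
  then show ?thesis
    using assms(2) by (simp add: algebra_simps)
qed

lemma dcx_fun_abs_lower:
  fixes f :: "real^'m \<Rightarrow> real"
  assumes "dcx_fun f" "f x \<le> 0" "h \<le> 0" "k \<le> 0"
  shows "\<bar>f x\<bar> \<le> \<bar>f (x + h)\<bar> + \<bar>f (x + k)\<bar> + \<bar>f (x + h + k)\<bar>"
proof -
  have "f (x + h + k + (- h)) + f (x + h + k + (- k)) \<le> f (x + h + k + (- h) + (- k)) + f (x + h + k)"
    using assms(3,4) by (intro dcx_funD[OF assms(1)]) (auto simp: less_eq_vec_def)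
  then show ?thesis
    using assms(2) by (simp add: algebra_simps)
qed

section \<open>Growth of directionally convex functions\<close>

text \<open>Q is the precision matrix. The normalising constant is left out; means are quotients of
  such integrals.\<close>

definition gauss :: "real^'m^'m \<Rightarrow> real^'m \<Rightarrow> real" where
  "gauss Q x = exp (- (x \<bullet> (Q *v x)) / 2)"

lemma gauss_pos [simp]: "0 < gauss Q x"
  by (simp add: gauss_def)

lemma gauss_nonneg [simp]: "0 \<le> gauss Q x"
  by (simp add: gauss_def)

lemma continuous_on_matrix_vector [continuous_intros]:
  fixes A :: "real^'n^'m"
  shows "continuous_on S f \<Longrightarrow> continuous_on S (\<lambda>x. A *v f x)"
  using continuous_on_compose2[OF linear_continuous_on[OF matrix_vector_mul_bounded_linear[of A]]]
  by blast

lemma borel_measurable_matrix_vector [measurable]: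
  fixes A :: "real^'n^'m"
  assumes "f \<in> borel_measurable M"
  shows "(\<lambda>x. A *v f x) \<in> borel_measurable M"
  using assms by (rule measurable_compose)
    (intro borel_measurable_continuous_onI continuous_intros)

lemma borel_measurable_vec_nth [measurable]:
  fixes f :: "'a \<Rightarrow> real^'n"
  assumes "f \<in> borel_measurable M"
  shows "(\<lambda>x. f x $ i) \<in> borel_measurable M"
  using assms by (rule measurable_compose)
    (intro borel_measurable_continuous_onI continuous_intros)

lemma borel_measurable_gauss [measurable]: "gauss Q \<in> borel_measurable borel"
  unfolding gauss_def[abs_def] by (intro borel_measurable_continuous_onI continuous_intros) auto

lemma nn_integral_lborel_translate:
  fixes f :: "'a::euclidean_space \<Rightarrow> ennreal"
  assumes [measurable]: "f \<in> borel_measurable borel"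
  shows "(\<integral>\<^sup>+x. f (c + x) \<partial>lborel) = (\<integral>\<^sup>+x. f x \<partial>lborel)"
proof -
  have "(\<integral>\<^sup>+x. f x \<partial>lborel) = (\<integral>\<^sup>+x. f x \<partial>distr lborel borel ((+) c))"
    by (simp add: lborel_distr_plus)
  also have "\<dots> = (\<integral>\<^sup>+x. f (c + x) \<partial>lborel)"
    by (rule nn_integral_distr) auto
  finally show ?thesis by simp
qed

lemma emeasure_unit_box:
  fixes a :: "real^'m"
  shows "emeasure lborel (cbox a (a + 1)) = 1"
proof -
  have 1: "(1::real^'m) \<bullet> b = 1" if "b \<in> Basis" for b
    using that by (auto simp: Basis_vec_def inner_axis)
  then show ?thesis
    by (subst emeasure_lborel_cbox) (auto simp: inner_add_left)
qed

text \<open>The three-point bounds are averaged over unit cubes for both increments. Each of the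
  three terms is a translate of |f| and costs at most one box integral, whence the factor 3.\<close>

lemma dcx_fun_local_bound:
  fixes f :: "real^'m \<Rightarrow> real"
  assumes f: "dcx_fun f" and [measurable]: "f \<in> borel_measurable borel"
  shows "ennreal \<bar>f x\<bar> \<le> 3 * (\<integral>\<^sup>+y. ennreal \<bar>f y\<bar> * indicator (cbox (x - 2) (x + 2)) y \<partial>lborel)"
    (is "_ \<le> 3 * ?J")
proof -
  \<comment> \<open>The sign of \<open>f x\<close> selects the orientation required by the matching
    three-point bound. Sums of the two increments have coordinates in [-2, 2], the reach of the
    box.\<close>
  define A :: "(real^'m) set" where "A = (if 0 \<le> f x then cbox 0 1 else cbox (-1) 0)"
  define B :: "(real^'m) set" where "B = cbox (-1) 0"
  have [measurable]: "A \<in> sets borel" "B \<in> sets borel"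
    by (auto simp: A_def B_def)
  have eA: "emeasure lborel A = 1" and eB: "emeasure lborel B = 1"
    using emeasure_unit_box[of "0::real^'m"] emeasure_unit_box[of "-1::real^'m"]
    by (auto simp: A_def B_def)
  have bnd: "\<bar>f x\<bar> \<le> \<bar>f (x + a)\<bar> + \<bar>f (x + b)\<bar> + \<bar>f (x + a + b)\<bar>" if "a \<in> A" "b \<in> B" for a b
  proof (cases "0 \<le> f x")
    case True
    with that show ?thesis
      by (intro dcx_fun_abs_upper[OF f]) (auto simp: A_def B_def mem_box_cart less_eq_vec_def)
  next
    case False
    with that show ?thesis
      by (intro dcx_fun_abs_lower[OF f]) (auto simp: A_def B_def mem_box_cart less_eq_vec_def)
  qed
  have Arange: "-1 \<le> a $ i \<and> a $ i \<le> 1" if "a \<in> A" for a i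
    using that by (auto simp: A_def mem_box_cart split: if_splits dest!: spec[of _ i])
  have Brange: "-1 \<le> b $ i \<and> b $ i \<le> 1" if "b \<in> B" for b i
    using that by (auto simp: B_def mem_box_cart dest!: spec[of _ i])
  have trans: "(\<integral>\<^sup>+b. ennreal \<bar>f (c + b)\<bar> * indicator D b \<partial>lborel) \<le> ?J"
    if [measurable]: "D \<in> sets borel" and D: "\<And>b. b \<in> D \<Longrightarrow> c + b \<in> cbox (x - 2) (x + 2)" for c D
  proof -
    have "(\<integral>\<^sup>+b. ennreal \<bar>f (c + b)\<bar> * indicator D b \<partial>lborel) \<le>
      (\<integral>\<^sup>+b. ennreal \<bar>f (c + b)\<bar> * indicator (cbox (x - 2) (x + 2)) (c + b) \<partial>lborel)"
      using D by (intro nn_integral_mono) (auto split: split_indicator)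
    also have "\<dots> = ?J"
      by (rule nn_integral_lborel_translate) measurable
    finally show ?thesis .
  qed
  have JA: "(\<integral>\<^sup>+a. ennreal \<bar>f (x + a)\<bar> * indicator A a \<partial>lborel) \<le> ?J"
    using Arange by (intro trans) (auto simp: mem_box_cart, (smt (verit))+)
  have JB: "(\<integral>\<^sup>+b. ennreal \<bar>f (x + b)\<bar> * indicator B b \<partial>lborel) \<le> ?J"
    using Brange by (intro trans) (auto simp: mem_box_cart, (smt (verit))+)
  have JAB: "(\<integral>\<^sup>+b. ennreal \<bar>f (x + a + b)\<bar> * indicator B b \<partial>lborel) \<le> ?J" if "a \<in> A" for a
  proof (intro trans)
    fix b assume b: "b \<in> B"
    have "x $ i - 2 \<le> x $ i + a $ i + b $ i \<and> x $ i + a $ i + b $ i \<le> x $ i + 2" for i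
      using Arange[OF that, of i] Brange[OF b, of i] by linarith
    then show "x + a + b \<in> cbox (x - 2) (x + 2)"
      by (simp add: mem_box_cart)
  qed simp
  have step: "ennreal \<bar>f x\<bar> \<le> ennreal \<bar>f (x + a)\<bar> + 2 * ?J" if a: "a \<in> A" for a
  proof -
    have "ennreal \<bar>f x\<bar> = (\<integral>\<^sup>+b. ennreal \<bar>f x\<bar> * indicator B b \<partial>lborel)"
      by (simp add: nn_integral_cmult eB)
    also have "\<dots> \<le> (\<integral>\<^sup>+b. ennreal \<bar>f (x + a)\<bar> * indicator B b +
        (ennreal \<bar>f (x + b)\<bar> * indicator B b + ennreal \<bar>f (x + a + b)\<bar> * indicator B b) \<partial>lborel)"
    proof (intro nn_integral_mono)
      fix b
      show "ennreal \<bar>f x\<bar> * indicator B b \<le> ennreal \<bar>f (x + a)\<bar> * indicator B b +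
        (ennreal \<bar>f (x + b)\<bar> * indicator B b + ennreal \<bar>f (x + a + b)\<bar> * indicator B b)"
        using bnd[OF a, of b]
        by (auto split: split_indicator simp flip: ennreal_plus simp: ennreal_leI algebra_simps)
    qed
    also have "\<dots> = ennreal \<bar>f (x + a)\<bar> + ((\<integral>\<^sup>+b. ennreal \<bar>f (x + b)\<bar> * indicator B b \<partial>lborel) +
        (\<integral>\<^sup>+b. ennreal \<bar>f (x + a + b)\<bar> * indicator B b \<partial>lborel))"
      by (simp add: nn_integral_add nn_integral_cmult eB)
    also have "\<dots> \<le> ennreal \<bar>f (x + a)\<bar> + (?J + ?J)"
      by (intro add_mono order_refl JB JAB[OF a])
    finally show ?thesis by (simp add: mult_2)
  qed
  have "ennreal \<bar>f x\<bar> = (\<integral>\<^sup>+a. ennreal \<bar>f x\<bar> * indicator A a \<partial>lborel)"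
    by (simp add: nn_integral_cmult eA)
  also have "\<dots> \<le> (\<integral>\<^sup>+a. ennreal \<bar>f (x + a)\<bar> * indicator A a + 2 * ?J * indicator A a \<partial>lborel)"
    using step by (intro nn_integral_mono) (auto split: split_indicator)
  also have "\<dots> = (\<integral>\<^sup>+a. ennreal \<bar>f (x + a)\<bar> * indicator A a \<partial>lborel) + 2 * ?J"
    by (subst nn_integral_add) (auto simp: nn_integral_cmult eA)
  also have "\<dots> \<le> ?J + 2 * ?J"
    by (intro add_mono JA order_refl)
  also have "\<dots> = 3 * ?J"
    by (metis (no_types, lifting) distrib_right mult_1 one_plus_numeral semiring_norm(3))
  finally show ?thesis .
qed

text \<open>On the box around x the Gaussian is at least a constant times exp(-k q(x) / 2) for the
  form q of Q, so the box integral of |f| is controlled by its Gaussian integral. The excess of k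
  over 1 pays for moving inside the box.\<close>

lemma dcx_fun_gauss_growth:
  fixes f :: "real^'m \<Rightarrow> real"
  assumes f: "dcx_fun f" and [measurable]: "f \<in> borel_measurable borel"
    and Q: "pos_def Q" and int: "integrable lborel (\<lambda>x. f x * gauss Q x)" and k: "k > 1"
  obtains C where "\<And>x. \<bar>f x\<bar> \<le> C * exp (k * (x \<bullet> (Q *v x)) / 2)"
proof -
  define e where "e = k - 1"
  have e: "e > 0" "1 + e = k" using k by (auto simp: e_def)
  obtain B where B: "B > 0" "\<And>x. x \<bullet> (Q *v x) \<le> B * (norm x)\<^sup>2"
    using quad_form_upper[of Q] by blast
  obtain R where R: "\<And>d::real^'m. d \<in> cbox (-2) 2 \<Longrightarrow> norm d \<le> R"
    using bounded_cbox[of "-2::real^'m" 2] unfolding bounded_iff by blast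
  define K where "K = (1 + 1 / e) * (B * R\<^sup>2)"
  define I where "I = (\<integral>x. \<bar>f x * gauss Q x\<bar> \<partial>lborel)"
  have I0: "0 \<le> I" unfolding I_def by simp
  have "\<bar>f x\<bar> \<le> (3 * I * exp (K / 2)) * exp (k * (x \<bullet> (Q *v x)) / 2)" for x
  proof -
    let ?m = "exp (K / 2) * exp (k * (x \<bullet> (Q *v x)) / 2)"
    have low: "1 \<le> ?m * gauss Q y" if "y \<in> cbox (x - 2) (x + 2)" for y
    proof -
      have d: "y - x \<in> cbox (-2) 2"
        using that by (simp add: mem_box_cart algebra_simps)
      have "(y - x) \<bullet> (Q *v (y - x)) \<le> B * R\<^sup>2"
        using B(1) by (intro order_trans[OF B(2)] mult_left_mono power_mono R[OF d]) auto
      then have "(1 + 1 / e) * ((y - x) \<bullet> (Q *v (y - x))) \<le> K"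
        unfolding K_def using e by (intro mult_left_mono) auto
      with quad_form_perturb[OF Q e(1), of x "y - x"] e(2)
      have "y \<bullet> (Q *v y) \<le> k * (x \<bullet> (Q *v x)) + K"
        by simp
      then show ?thesis
        unfolding gauss_def by (simp flip: exp_add)
    qed
    have "(\<integral>\<^sup>+y. ennreal \<bar>f y\<bar> * indicator (cbox (x - 2) (x + 2)) y \<partial>lborel) \<le>
      (\<integral>\<^sup>+y. ennreal ?m * ennreal \<bar>f y * gauss Q y\<bar> \<partial>lborel)"
    proof (intro nn_integral_mono)
      fix y
      have "\<bar>f y\<bar> \<le> ?m * \<bar>f y * gauss Q y\<bar>" if "y \<in> cbox (x - 2) (x + 2)"
        using mult_right_mono[OF low[OF that], of "\<bar>f y\<bar>"] by (simp add: abs_mult ac_simps)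
      then show "ennreal \<bar>f y\<bar> * indicator (cbox (x - 2) (x + 2)) y \<le> ennreal ?m * ennreal \<bar>f y * gauss Q y\<bar>"
        by (auto split: split_indicator simp flip: ennreal_mult simp: ennreal_leI)
    qed
    also have "\<dots> = ennreal ?m * (\<integral>\<^sup>+y. ennreal \<bar>f y * gauss Q y\<bar> \<partial>lborel)"
      by (rule nn_integral_cmult) measurable
    also have "(\<integral>\<^sup>+y. ennreal \<bar>f y * gauss Q y\<bar> \<partial>lborel) = ennreal I"
      unfolding I_def using int by (intro nn_integral_eq_integral) auto
    finally have "3 * (\<integral>\<^sup>+y. ennreal \<bar>f y\<bar> * indicator (cbox (x - 2) (x + 2)) y \<partial>lborel) \<le> 3 * (ennreal ?m * ennreal I)"
      by (intro mult_left_mono) auto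
    also have "\<dots> = ennreal (3 * (?m * I))"
      using I0 by (simp add: ennreal_mult)
    finally have "ennreal \<bar>f x\<bar> \<le> ennreal (3 * (?m * I))"
      using dcx_fun_local_bound[OF f, of x] by (meson order_trans assms(2))
    then have "\<bar>f x\<bar> \<le> 3 * (?m * I)"
      using I0 by (subst (asm) ennreal_le_iff) auto
    then show ?thesis by (simp add: ac_simps)
  qed
  then show thesis by (rule that)
qed

section \<open>Order intervals and quadratic forms of entrywise ordered matrices\<close>

lemma quad_form_mono:
  fixes A B :: "real^'m^'m"
  assumes "A \<le> B" "0 \<le> x"
  shows "x \<bullet> (A *v x) \<le> x \<bullet> (B *v x)"
  unfolding inner_vec_def matrix_vector_mult_def using assms
  by (auto intro!: sum_mono mult_left_mono mult_right_mono simp: less_eq_vec_def)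

text \<open>First-order condition at a minimum: divide by t and let t tend to 0.\<close>

lemma nonneg_of_quadratic_nonneg:
  fixes a b :: real
  assumes "\<And>t. 0 < t \<Longrightarrow> t \<le> 1 \<Longrightarrow> 0 \<le> 2 * t * a + t\<^sup>2 * b"
  shows "0 \<le> a"
proof (rule ccontr)
  assume a: "\<not> 0 \<le> a"
  \<comment> \<open>Small enough that \<open>t * b\<close> is at most \<open>- a\<close>, which
    forces \<open>2 * a + t * b\<close> below 0.\<close>
  define t where "t = min 1 (- a / (\<bar>b\<bar> + 1))"
  have t: "0 < t" "t \<le> 1" "t \<le> - a / (\<bar>b\<bar> + 1)"
    using a by (auto simp: t_def divide_neg_pos)
  then have t3: "t * (\<bar>b\<bar> + 1) \<le> - a"
    using pos_le_divide_eq[of "\<bar>b\<bar> + 1" t "- a"] by auto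
  have "0 \<le> t * (2 * a + t * b)"
    using assms[OF t(1,2)] by (simp add: power2_eq_square algebra_simps)
  then have "0 \<le> 2 * a + t * b"
    using t(1) by (simp add: zero_le_mult_iff)
  moreover have "t * b \<le> t * (\<bar>b\<bar> + 1)"
    using t by (intro mult_left_mono) auto
  ultimately show False using t3 a by linarith
qed

text \<open>Minimise the quadratic form of \<open>B\<inverse>\<close> over \<open>{v. x \<le> v}\<close>. The multiplier \<open>B\<inverse> v\<close> is then
  nonnegative, so Cauchy--Schwarz with \<open>A \<le> B\<close> bounds the minimum.\<close>

lemma dominating_point:
  fixes A B :: "real^'m^'m"
  assumes A: "pos_def A" and B: "pos_def B" and le: "A \<le> B"
  obtains v where "x \<le> v" "v \<bullet> (matrix_inv B *v v) \<le> x \<bullet> (matrix_inv A *v x)"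
proof -
  let ?q = "\<lambda>v. v \<bullet> (matrix_inv B *v v)"
  note Q = pos_def_matrix_inv[OF B]
  obtain c where c: "c > 0" "\<And>v. c * (norm v)\<^sup>2 \<le> ?q v"
    using quad_form_lower[OF Q] by blast
  \<comment> \<open>Outside the ball the form exceeds its value at x, so the cut provides
    compactness without losing the minimum.\<close>
  define K where "K = {v. x \<le> v} \<inter> {v. c * (norm v)\<^sup>2 \<le> ?q x}"
  have ball: "{v::real^'m. c * (norm v)\<^sup>2 \<le> ?q x} = cball 0 (sqrt (?q x / c))"
  proof -
    have "norm v \<le> sqrt (?q x / c) \<longleftrightarrow> (norm v)\<^sup>2 \<le> ?q x / c" for v :: "real^'m"
      by (metis abs_norm_cancel real_sqrt_abs real_sqrt_le_iff)
    then have *: "c * (norm v)\<^sup>2 \<le> ?q x \<longleftrightarrow> norm v \<le> sqrt (?q x / c)" for v :: "real^'m"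
      using c(1) by (simp only: pos_le_divide_eq mult.commute[of c])
    show ?thesis
      by (rule set_eqI) (simp only: mem_Collect_eq mem_cball_0 *)
  qed
  have "{v. x \<le> v} = (\<Inter>i. {v. x $ i \<le> v $ i})"
    by (auto simp: less_eq_vec_def)
  then have "closed {v. x \<le> v}"
    by (simp add: closed_INT closed_Collect_le continuous_on_component continuous_on_id continuous_on_const)
  then have "compact K"
    unfolding K_def ball by (rule closed_Int_compact) (rule compact_cball)
  moreover have "x \<in> K"
    using c(2)[of x] by (simp add: K_def)
  moreover have "continuous_on K ?q"
    by (intro continuous_intros)
  ultimately obtain v where v: "v \<in> K" and min: "\<And>y. y \<in> K \<Longrightarrow> ?q v \<le> ?q y"
    using continuous_attains_inf[of K ?q] by blast
  have xv: "x \<le> v" using v by (simp add: K_def)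
  have min': "?q v \<le> ?q y" if "x \<le> y" for y
  proof (cases "y \<in> K")
    case False
    then have "?q x < c * (norm y)\<^sup>2" using that by (auto simp: K_def)
    with c(2)[of y] min[OF \<open>x \<in> K\<close>] show ?thesis by linarith
  qed (rule min)
  let ?l = "matrix_inv B *v v"
  \<comment> \<open>Variational inequality: the segment from v to y stays in the convex set of
    points above x, so the form has nonnegative slope at v along it.\<close>
  have opt: "0 \<le> (y - v) \<bullet> ?l" if "x \<le> y" for y
  proof (rule nonneg_of_quadratic_nonneg)
    fix t :: real
    assume t: "0 < t" "t \<le> 1"
    have "x $ i \<le> (v + t *\<^sub>R (y - v)) $ i" for i
    proof -
      have "x $ i = (1 - t) * x $ i + t * x $ i" by (simp add: algebra_simps)
      also have "\<dots> \<le> (1 - t) * v $ i + t * y $ i"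
        using t xv that by (intro add_mono mult_left_mono) (auto simp: less_eq_vec_def)
      finally show ?thesis by (simp add: algebra_simps)
    qed
    then have "?q v \<le> ?q (v + t *\<^sub>R (y - v))"
      by (intro min') (simp add: less_eq_vec_def)
    also have "\<dots> = ?q v + 2 * t * ((y - v) \<bullet> ?l) + t\<^sup>2 * ?q (y - v)"
      unfolding quad_form_add[OF Q]
      using pos_def_inner[OF Q, of v "y - v"]
      by (simp add: matrix_vector_mult_scaleR power2_eq_square inner_commute)
    finally show "0 \<le> 2 * t * ((y - v) \<bullet> ?l) + t\<^sup>2 * ?q (y - v)" by simp
  qed
  have l_nonneg: "0 \<le> ?l $ i" for i
  proof -
    have "x \<le> v + axis i 1"
      using xv by (auto simp: less_eq_vec_def axis_def intro: add_increasing2)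
    from opt[OF this] show ?thesis
      by (simp add: inner_axis')
  qed
  \<comment> \<open>Complementary slackness: one inequality tests optimality with y = x, the other
    uses that \<open>v - x\<close> and the multiplier are nonnegative.\<close>
  have "v \<bullet> ?l \<le> x \<bullet> ?l"
    using opt[of x] by (simp add: inner_diff_left)
  moreover have "x \<bullet> ?l \<le> v \<bullet> ?l"
    unfolding inner_vec_def using xv l_nonneg
    by (intro sum_mono) (simp add: mult_right_mono less_eq_vec_def)
  ultimately have eq: "x \<bullet> ?l = ?q v" by simp
  \<comment> \<open>The entrywise order compares quadratic forms on nonnegative vectors, hence the
    need for a nonnegative multiplier.\<close>
  have "?l \<bullet> (A *v ?l) \<le> ?l \<bullet> (B *v ?l)"
    using le l_nonneg by (intro quad_form_mono) (simp_all add: less_eq_vec_def)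
  also have "\<dots> = ?q v"
    by (simp add: pos_def_inverse_vector[OF B] inner_commute)
  finally have lAl: "?l \<bullet> (A *v ?l) \<le> ?q v" .
  \<comment> \<open>Since \<open>x \<bullet> ?l\<close> equals the minimum, its square is at most
    x^T A^{-1} x times the minimum, and one factor cancels.\<close>
  have "(?q v)\<^sup>2 \<le> (x \<bullet> (matrix_inv A *v x)) * (?l \<bullet> (A *v ?l))"
    using pos_def_cauchy_dual[OF A, of x ?l] eq by simp
  also have "\<dots> \<le> (x \<bullet> (matrix_inv A *v x)) * ?q v"
    by (intro mult_left_mono lAl pos_def_nonneg pos_def_matrix_inv A)
  finally have "?q v * ?q v \<le> (x \<bullet> (matrix_inv A *v x)) * ?q v"
    by (simp add: power2_eq_square)
  then have "?q v \<le> x \<bullet> (matrix_inv A *v x)"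
    using pos_def_nonneg[OF Q, of v] pos_def_nonneg[OF pos_def_matrix_inv[OF A], of x]
    by (cases "?q v = 0") (auto simp: mult_le_cancel_right)
  with xv that show thesis by blast
qed

text \<open>The lower corner is the negative of a point dominating \<open>- x\<close>; the quadratic
  forms are even.\<close>

lemma enclosing_box:
  fixes A B :: "real^'m^'m"
  assumes "pos_def A" "pos_def B" "A \<le> B"
  obtains u v where "u \<le> x" "x \<le> v"
    "u \<bullet> (matrix_inv B *v u) \<le> x \<bullet> (matrix_inv A *v x)"
    "v \<bullet> (matrix_inv B *v v) \<le> x \<bullet> (matrix_inv A *v x)"
proof -
  obtain v where v: "x \<le> v" "v \<bullet> (matrix_inv B *v v) \<le> x \<bullet> (matrix_inv A *v x)"
    using dominating_point[OF assms] by blast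
  obtain w where w: "- x \<le> w" "w \<bullet> (matrix_inv B *v w) \<le> (- x) \<bullet> (matrix_inv A *v (- x))"
    using dominating_point[OF assms] by blast
  have neg: "M *v (- y) = - (M *v y)" for M :: "real^'m^'m" and y
    using matrix_vector_mult_scaleR[of M "-1" y] by simp
  have "- w \<le> x"
    using w(1) by (auto simp: less_eq_vec_def) (metis minus_le_iff)
  with v w(2) that[of "- w" v] show thesis by (simp add: neg)
qed

text \<open>Absorbs a factor linear in s at the price of an arbitrarily small exponential
  rate.\<close>

lemma linear_le_exp:
  fixes a s e :: real
  assumes "0 \<le> s" "0 \<le> a" "0 \<le> b" "0 < e"
  shows "a + b * s \<le> (a + b / e) * exp (e * s)"
proof -
  have "1 \<le> exp (e * s)" using assms by simp
  then have "a * 1 \<le> a * exp (e * s)" using assms by (intro mult_left_mono)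
  moreover have "e * s \<le> exp (e * s)"
    using exp_ge_add_one_self[of "e * s"] by linarith
  then have "(b / e) * (e * s) \<le> (b / e) * exp (e * s)"
    using assms by (intro mult_left_mono) auto
  ultimately show ?thesis using assms by (simp add: distrib_right)
qed

text \<open>The lower bound extrapolates from u in steps of length at most 1, whose number grows
  linearly in s. The upper bound follows from the inequality on the order interval, because the
  mirror image of x lies in the same interval.\<close>

lemma dcx_fun_box_growth:
  fixes f :: "real^'m \<Rightarrow> real"
  assumes f: "dcx_fun f" and Q: "pos_def Q" and k: "0 < k" "k < k'"
    and C: "\<And>x. \<bar>f x\<bar> \<le> C * exp (k * (x \<bullet> (Q *v x)) / 2)"
  obtains C' where "\<And>u x v s. u \<le> x \<Longrightarrow> x \<le> v \<Longrightarrow> u \<bullet> (Q *v u) \<le> s \<Longrightarrow> v \<bullet> (Q *v v) \<le> s \<Longrightarrow>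
    \<bar>f x\<bar> \<le> C' * exp (k' * s / 2)"
proof -
  \<comment> \<open>The gap from k to k' is split at its midpoint: e pays for moving from u to
    \<open>u - h\<close> and raises the rate to k2, d pays for the number of steps and raises it to
    k'.\<close>
  define k2 where "k2 = (k + k') / 2"
  define e where "e = (k' - k) / (2 * k)"
  define d where "d = (k' - k) / 4"
  have e: "e > 0" "k * (1 + e) = k2" and d: "d > 0" "k2 / 2 + d = k' / 2" and k2: "k < k2" "0 < k2"
    using k by (auto simp: e_def k2_def d_def field_simps)
  obtain B where B: "B > 0" "\<And>x. x \<bullet> (Q *v x) \<le> B * (norm x)\<^sup>2"
    using quad_form_upper[of Q] by blast
  obtain c where c: "c > 0" "\<And>x. c * (norm x)\<^sup>2 \<le> x \<bullet> (Q *v x)"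
    using quad_form_lower[OF Q] by blast
  have C0: "0 \<le> C" using C[of 0] by simp
  define C3 where "C3 = C * exp (k * ((1 + 1 / e) * B) / 2)"
  have C3: "C \<le> C3" "0 \<le> C3"
    unfolding C3_def using C0 B e k by (auto intro!: mult_le_cancel_left1[THEN iffD2])
  \<comment> \<open>From \<open>2 * real n + 1 \<le> 9 + (4 / c) * s\<close> below, with the linear
    term absorbed at rate d.\<close>
  define C2 where "C2 = 9 + (4 / c) / d"
  have bnd: "\<bar>f (u - h)\<bar> \<le> C3 * exp (k2 * s / 2)"
    if u: "u \<bullet> (Q *v u) \<le> s" and h: "norm h \<le> 1" for u h s
  proof -
    have "(- h) \<bullet> (Q *v (- h)) \<le> B * 1\<^sup>2"
      using B(1) h by (intro order_trans[OF B(2)] mult_left_mono power_mono) auto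
    then have "(1 + 1 / e) * ((- h) \<bullet> (Q *v (- h))) \<le> (1 + 1 / e) * B"
      using e by (intro mult_left_mono) auto
    moreover have "(1 + e) * (u \<bullet> (Q *v u)) \<le> (1 + e) * s"
      using u e by (intro mult_left_mono) auto
    ultimately have "(u - h) \<bullet> (Q *v (u - h)) \<le> (1 + e) * s + (1 + 1 / e) * B"
      using quad_form_perturb[OF Q e(1), of u "- h"] by simp
    then have "k * ((u - h) \<bullet> (Q *v (u - h))) \<le> k * ((1 + e) * s + (1 + 1 / e) * B)"
      using k by (intro mult_left_mono) auto
    also have "\<dots> = k2 * s + k * ((1 + 1 / e) * B)"
      by (simp add: distrib_left e(2)[symmetric])
    finally have "exp (k * ((u - h) \<bullet> (Q *v (u - h))) / 2) \<le>
        exp (k * ((1 + 1 / e) * B) / 2) * exp (k2 * s / 2)"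
      by (simp flip: exp_add add: add_divide_distrib)
    from mult_left_mono[OF this C0] have "C * exp (k * ((u - h) \<bullet> (Q *v (u - h))) / 2) \<le> C3 * exp (k2 * s / 2)"
      by (simp only: C3_def mult.assoc)
    with C[of "u - h"] show ?thesis by (rule order_trans)
  qed
  have main: "\<bar>f x\<bar> \<le> (C2 * C3 + 2 * C3) * exp (k' * s / 2)"
    if ux: "u \<le> x" and xv: "x \<le> v" and us: "u \<bullet> (Q *v u) \<le> s" and vs: "v \<bullet> (Q *v v) \<le> s" for u x v s
  proof -
    have s0: "0 \<le> s" using pos_def_nonneg[OF Q, of u] us by linarith
    have fu: "\<bar>f u\<bar> \<le> C3 * exp (k2 * s / 2)" and fv: "\<bar>f v\<bar> \<le> C3 * exp (k2 * s / 2)"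
      using bnd[OF us, of 0] bnd[OF vs, of 0] by auto
    have nrm: "norm w \<le> 1 + s / c" if "w \<bullet> (Q *v w) \<le> s" for w
    proof -
      have "(norm w)\<^sup>2 \<le> s / c"
        using c(1) c(2)[of w] that by (simp add: field_simps)
      moreover have "norm w \<le> 1 + (norm w)\<^sup>2"
        using sum_squares_ge_zero[of "norm w - 1" "norm w"] by (simp add: power2_eq_square algebra_simps)
      ultimately show ?thesis by linarith
    qed
    have low: "- (C2 * C3 * exp (k' * s / 2)) \<le> f y" if uy: "u \<le> y" and yv: "y \<le> v" for y
    proof -
      have "norm (y - u) \<le> norm (v - u)"
      proof (rule norm_le_componentwise_cart)
        show "norm ((y - u) $ i) \<le> norm ((v - u) $ i)" for i
          using uy[unfolded less_eq_vec_def, rule_format, of i] yv[unfolded less_eq_vec_def, rule_format, of i]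
          by simp
      qed
      also have "\<dots> \<le> norm v + norm u" by (rule norm_triangle_ineq4)
      finally have yu: "norm (y - u) \<le> 2 + 2 * (s / c)"
        using nrm[OF us] nrm[OF vs] by linarith
      \<comment> \<open>Rounding up keeps each step at most 1 long; the extra 1 keeps n positive
        when y = u.\<close>
      define n where "n = nat \<lceil>norm (y - u)\<rceil> + 1"
      have n: "norm (y - u) \<le> real n" "real n \<le> norm (y - u) + 2" "0 < real n"
        unfolding n_def using norm_ge_zero[of "y - u"] by linarith+
      define h where "h = (y - u) /\<^sub>R real n"
      have h: "norm h \<le> 1" "0 \<le> h" "u + real n *\<^sub>R h = y"
        using n uy by (auto simp: h_def less_eq_vec_def divide_inverse[symmetric] mult.commute[of "inverse _"])
      have "real n * (f u - f (u - h)) \<le> f y - f u"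
        using dcx_fun_extrapolate[OF f h(2), of n u] by (simp add: h(3))
      moreover have "- (real n * (2 * (C3 * exp (k2 * s / 2)))) \<le> real n * (f u - f (u - h))"
      proof -
        have "- (2 * (C3 * exp (k2 * s / 2))) \<le> f u - f (u - h)"
          using fu bnd[OF us h(1)] by linarith
        from mult_left_mono[OF this, of "real n"] show ?thesis by simp
      qed
      ultimately have "- ((2 * real n + 1) * (C3 * exp (k2 * s / 2))) \<le> f y"
        using fu by (simp add: algebra_simps)
      moreover have "(2 * real n + 1) * (C3 * exp (k2 * s / 2)) \<le> C2 * exp (d * s) * (C3 * exp (k2 * s / 2))"
      proof (intro mult_right_mono)
        have "2 * real n + 1 \<le> 9 + 4 * (s / c)"
          using n(2) yu by linarith
        also have "\<dots> = 9 + (4 / c) * s"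
          by simp
        also have "\<dots> \<le> C2 * exp (d * s)"
          unfolding C2_def using s0 c(1) d(1) by (intro linear_le_exp) auto
        finally show "2 * real n + 1 \<le> C2 * exp (d * s)" .
      qed (use C3 in auto)
      moreover have "C2 * exp (d * s) * (C3 * exp (k2 * s / 2)) = C2 * C3 * exp (k' * s / 2)"
      proof -
        have "d * s + k2 * s / 2 = k' * s / 2"
          by (simp add: d_def k2_def field_simps)
        then have "exp (k' * s / 2) = exp (d * s) * exp (k2 * s / 2)"
          by (metis exp_add)
        then show ?thesis by simp
      qed
      ultimately show ?thesis by linarith
    qed
    have "f x + f (u + v - x) \<le> f u + f v"
      by (rule dcx_fun_box[OF f ux xv])
    moreover have "- (C2 * C3 * exp (k' * s / 2)) \<le> f (u + v - x)"
      using ux xv by (intro low) (auto simp: less_eq_vec_def)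
    moreover have "C3 * exp (k2 * s / 2) \<le> C3 * exp (k' * s / 2)"
    proof -
      have "k2 * s / 2 \<le> k' * s / 2"
        using s0 k by (intro divide_right_mono mult_right_mono) (simp_all add: k2_def)
      then show ?thesis
        using C3 by (intro mult_left_mono) simp_all
    qed
    ultimately have "f x \<le> (C2 * C3 + 2 * C3) * exp (k' * s / 2)"
      using fu fv by (simp add: distrib_right)
    moreover have "- ((C2 * C3 + 2 * C3) * exp (k' * s / 2)) \<le> f x"
    proof -
      have "0 \<le> 2 * C3 * exp (k' * s / 2)" using C3 by simp
      with low[OF ux xv] show ?thesis
        unfolding distrib_right by linarith
    qed
    ultimately show ?thesis by linarith
  qed
  from main that show thesis by blast
qed

section \<open>Gaussian integrals of directionally convex functions\<close>

text \<open>The function factorises over an orthonormal basis into multiples of normal densities of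
  variance \<open>1 / (2 * c)\<close>.\<close>

lemma integrable_exp_neg_norm_square:
  fixes c :: real
  assumes "c > 0"
  shows "integrable lborel (\<lambda>x::'a::euclidean_space. exp (- (c * (norm x)\<^sup>2)))"
proof (rule integrableI_nonneg)
  define s where "s = 1 / sqrt (2 * c)"
  have s: "s > 0" "2 * s\<^sup>2 = 1 / c"
    using assms by (auto simp: s_def power_divide)
  have one: "(\<integral>\<^sup>+x. ennreal (exp (- (c * x\<^sup>2))) \<partial>lborel) < \<infinity>"
  proof -
    have "exp (- (c * x\<^sup>2)) = sqrt (2 * pi * s\<^sup>2) * normal_density 0 s x" for x
      using s(1) by (simp add: normal_density_def s(2) real_sqrt_mult)
    moreover have "integrable lborel (\<lambda>x. sqrt (2 * pi * s\<^sup>2) * normal_density 0 s x)"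
      using s(1) by (intro integrable_mult_right integrable_normal_density)
    ultimately have "integrable lborel (\<lambda>x. exp (- (c * x\<^sup>2)))"
      by simp
    then show ?thesis
      by (simp add: integrable_iff_bounded)
  qed
  have "(norm x)\<^sup>2 = (\<Sum>b\<in>Basis. (x \<bullet> b)\<^sup>2)" for x :: 'a
    unfolding power2_norm_eq_inner by (subst euclidean_inner) (simp add: power2_eq_square)
  then have "(\<integral>\<^sup>+x. ennreal (exp (- (c * (norm (x::'a))\<^sup>2))) \<partial>lborel) =
      (\<integral>\<^sup>+x. (\<Prod>b\<in>(Basis::'a set). ennreal (exp (- (c * (x \<bullet> b)\<^sup>2)))) \<partial>lborel)"
    by (simp add: prod_ennreal exp_sum[symmetric] sum_distrib_left sum_negf)
  also have "\<dots> = (\<Prod>b\<in>(Basis::'a set). \<integral>\<^sup>+x. ennreal (exp (- (c * x\<^sup>2))) \<partial>lborel)"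
    by (rule nn_integral_lborel_prod) auto
  also have "\<dots> < \<infinity>"
    using one by (simp add: power_less_top_ennreal)
  finally show "(\<integral>\<^sup>+x. ennreal (exp (- (c * (norm (x::'a))\<^sup>2))) \<partial>lborel) < \<infinity>" .
qed auto

text \<open>Completing the square leaves half of the quadratic decay.\<close>

lemma integrable_exp_norm:
  fixes a c :: real
  assumes "c > 0"
  shows "integrable lborel (\<lambda>x::'a::euclidean_space. exp (a * norm x - c * (norm x)\<^sup>2))"
proof (rule Bochner_Integration.integrable_bound)
  show "integrable lborel (\<lambda>x::'a. exp (a\<^sup>2 / (2 * c)) * exp (- ((c / 2) * (norm x)\<^sup>2)))"
    using assms by (intro integrable_mult_right integrable_exp_neg_norm_square) auto
  have "a * t - c * t\<^sup>2 \<le> a\<^sup>2 / (2 * c) + - ((c / 2) * t\<^sup>2)" for t :: real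
  proof -
    have "0 \<le> (a - c * t)\<^sup>2 / (2 * c)" using assms by simp
    also have "\<dots> = a\<^sup>2 / (2 * c) - a * t + (c / 2) * t\<^sup>2"
      using assms by (simp add: power2_eq_square field_simps)
    finally show ?thesis by linarith
  qed
  then show "AE x in lborel. norm (exp (a * norm x - c * (norm (x::'a))\<^sup>2)) \<le>
      norm (exp (a\<^sup>2 / (2 * c)) * exp (- ((c / 2) * (norm x)\<^sup>2)))"
    by (intro AE_I2) (simp flip: exp_add)
qed auto

text \<open>The common shape of the majorants below: the linear exponent absorbs polynomial factors
  and shifts of the Gaussian.\<close>

lemma integrable_exp_norm_bound:
  fixes g :: "'a::euclidean_space \<Rightarrow> real"
  assumes "c > 0" and [measurable]: "g \<in> borel_measurable borel"
    and "\<And>x. \<bar>g x\<bar> \<le> M * exp (a * norm x - c * (norm x)\<^sup>2)"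
  shows "integrable lborel g"
proof (rule Bochner_Integration.integrable_bound)
  show "integrable lborel (\<lambda>x::'a. M * exp (a * norm x - c * (norm x)\<^sup>2))"
    using assms(1) by (intro integrable_mult_right integrable_exp_norm)
  show "AE x in lborel. norm (g x) \<le> norm (M * exp (a * norm x - c * (norm x)\<^sup>2))"
    using assms(3) by (intro AE_I2) (simp add: order_trans[OF assms(3) abs_ge_self])
qed simp

lemma integrable_lborel_translate:
  fixes f :: "'a::euclidean_space \<Rightarrow> real"
  assumes "integrable lborel f"
  shows "integrable lborel (\<lambda>x. f (c + x))" "(\<integral>x. f (c + x) \<partial>lborel) = (\<integral>x. f x \<partial>lborel)"
proof -
  have m [measurable]: "f \<in> borel_measurable borel"
    using assms by auto
  have "integrable (distr lborel borel ((+) c)) f"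
    using assms by (simp add: lborel_distr_plus)
  then show "integrable lborel (\<lambda>x. f (c + x))"
    by (subst (asm) integrable_distr_eq) auto
  have "(\<integral>x. f x \<partial>lborel) = (\<integral>x. f x \<partial>distr lborel borel ((+) c))"
    by (simp add: lborel_distr_plus)
  also have "\<dots> = (\<integral>x. f (c + x) \<partial>lborel)"
    by (rule integral_distr) auto
  finally show "(\<integral>x. f (c + x) \<partial>lborel) = (\<integral>x. f x \<partial>lborel)" by simp
qed

lemma abs_exp_diff_le:
  fixes a b :: real
  shows "\<bar>exp a - exp b\<bar> \<le> \<bar>a - b\<bar> * (exp a + exp b)"
proof -
  have *: "exp y - exp x \<le> (y - x) * exp y" if "x \<le> y" for x y :: real
  proof -
    have "1 + (x - y) \<le> exp (x - y)" by (rule exp_ge_add_one_self)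
    from mult_right_mono[OF this, of "exp y"] show ?thesis
      by (simp add: exp_diff algebra_simps)
  qed
  show ?thesis
  proof (cases "a \<le> b")
    case True
    have "(b - a) * exp b \<le> (b - a) * (exp a + exp b)"
      using True by (intro mult_left_mono) auto
    with *[OF True] True show ?thesis by auto
  next
    case False
    then have ba: "b \<le> a" by simp
    have "(a - b) * exp a \<le> (a - b) * (exp a + exp b)"
      using ba by (intro mult_left_mono) auto
    with *[OF ba] ba show ?thesis by auto
  qed
qed

lemma abs_exp_minus_one_le: "\<bar>exp y - 1\<bar> \<le> \<bar>y\<bar> * exp \<bar>y\<bar>" for y :: real
proof (cases "0 \<le> y")
  case True
  have "1 + - y \<le> exp (- y)" by (rule exp_ge_add_one_self)
  from mult_right_mono[OF this, of "exp y"] True show ?thesis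
    by (simp add: algebra_simps exp_minus)
next
  case False
  have "1 + y \<le> exp y" by (rule exp_ge_add_one_self)
  moreover have "\<bar>y\<bar> * 1 \<le> \<bar>y\<bar> * exp \<bar>y\<bar>" by (intro mult_left_mono) auto
  moreover have "exp y \<le> 1" using False by simp
  ultimately show ?thesis using False by linarith
qed

lemma abs_component_matrix_vector_le:
  fixes A :: "real^'m^'m"
  obtains L where "L > 0" "\<And>x. norm (A *v x) \<le> L * norm x" "\<And>x i. \<bar>(A *v x) $ i\<bar> \<le> L * norm x"
    "\<And>i j. \<bar>A $ i $ j\<bar> \<le> L"
proof -
  obtain L where L: "L > 0" "\<And>x. norm (A *v x) \<le> L * norm x"
    using linear_bounded_pos[OF matrix_vector_mul_linear[of A]] by blast
  have 1: "\<bar>(A *v x) $ i\<bar> \<le> L * norm x" for x i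
    by (rule order_trans[OF component_le_norm_cart L(2)])
  have "(A *v axis j 1) $ i = A $ i $ j" for i j
    by (simp add: matrix_vector_mul_component inner_axis)
  then have "\<bar>A $ i $ j\<bar> \<le> L" for i j
    using 1[of "axis j 1" i] by simp
  with L 1 that show thesis by blast
qed

lemma gauss_shift:
  assumes "pos_def Q"
  shows "gauss Q (x - h) = gauss Q x * exp (h \<bullet> (Q *v x) - h \<bullet> (Q *v h) / 2)"
  unfolding gauss_def quad_form_diff[OF assms]
  using pos_def_inner[OF assms, of x h]
  by (simp flip: exp_add add: field_simps inner_commute)

text \<open>Moving two difference operators from \<open>f\<close> onto the Gaussian and letting the step tend to \<open>0\<close>
  yields \<open>\<integral> f \<partial>\<^sub>i \<partial>\<^sub>j gauss \<ge> 0\<close> without any smoothness of \<open>f\<close>.\<close>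

lemma dcx_fun_gauss_second_derivative:
  fixes f :: "real^'m \<Rightarrow> real"
  assumes f: "dcx_fun f" and [measurable]: "f \<in> borel_measurable borel" and Q: "pos_def Q"
    and b: "b < 1" and C: "\<And>x. \<bar>f x\<bar> \<le> C * exp (b * (x \<bullet> (Q *v x)) / 2)"
  shows "integrable lborel (\<lambda>x. f x * gauss Q x)" (is ?int0)
    "integrable lborel (\<lambda>x. f x * (Q *v x) $ i * (Q *v x) $ j * gauss Q x)" (is ?int2)
    "Q $ i $ j * (\<integral>x. f x * gauss Q x \<partial>lborel) \<le>
      (\<integral>x. f x * (Q *v x) $ i * (Q *v x) $ j * gauss Q x \<partial>lborel)" (is ?le)
proof -
  obtain c0 where c0: "c0 > 0" "\<And>x. c0 * (norm x)\<^sup>2 \<le> x \<bullet> (Q *v x)"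
    using quad_form_lower[OF Q] by blast
  \<comment> \<open>The decay left of the Gaussian exponent after the growth of f is subtracted,
    measured by the norm.\<close>
  define c where "c = (1 - b) * c0 / 2"
  have c: "c > 0" using b c0 by (simp add: c_def)
  have C0: "0 \<le> C" using C[of 0] by simp
  obtain L where L: "L > 0" "\<And>x. norm (Q *v x) \<le> L * norm x" "\<And>x i. \<bar>(Q *v x) $ i\<bar> \<le> L * norm x"
    "\<And>i j. \<bar>Q $ i $ j\<bar> \<le> L"
    using abs_component_matrix_vector_le[of Q] by blast
  have fg: "\<bar>f x\<bar> * gauss Q x \<le> C * exp (- (c * (norm x)\<^sup>2))" for x
  proof -
    have "(1 - b) / 2 * (c0 * (norm x)\<^sup>2) \<le> (1 - b) / 2 * (x \<bullet> (Q *v x))"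
      using b by (intro mult_left_mono c0) auto
    then have "b * (x \<bullet> (Q *v x)) / 2 + - (x \<bullet> (Q *v x)) / 2 \<le> - (c * (norm x)\<^sup>2)"
      by (simp add: c_def field_simps)
    then have "exp (b * (x \<bullet> (Q *v x)) / 2) * gauss Q x \<le> exp (- (c * (norm x)\<^sup>2))"
      unfolding gauss_def by (simp flip: exp_add)
    from mult_left_mono[OF this C0] order_trans[OF mult_right_mono[OF C[of x] gauss_nonneg[of Q x]]] show ?thesis
      by simp
  qed
  have bound: "\<bar>f x * g * gauss Q x\<bar> \<le> (C * M) * exp (a * norm x - c * (norm x)\<^sup>2)"
    if "\<bar>g\<bar> \<le> M * exp (a * norm x)" for x g M a
  proof -
    have "\<bar>f x * g * gauss Q x\<bar> = (\<bar>f x\<bar> * gauss Q x) * \<bar>g\<bar>"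
      by (simp add: abs_mult)
    also have "\<dots> \<le> (C * exp (- (c * (norm x)\<^sup>2))) * (M * exp (a * norm x))"
      using C0 by (intro mult_mono fg that) auto
    also have "\<dots> = (C * M) * exp (a * norm x - c * (norm x)\<^sup>2)"
      by (simp add: exp_diff exp_minus field_simps)
    finally show ?thesis .
  qed
  show ?int0
    using bound[of 1 1 0] by (intro integrable_exp_norm_bound[OF c, of _ C 0]) auto
  have lin_exp: "t \<le> exp t" for t :: real
    using exp_ge_add_one_self[of t] by linarith
  have comp: "\<bar>(Q *v x) $ i\<bar> \<le> exp (L * norm x)" for x i
    by (rule order_trans[OF L(3) lin_exp])
  have "\<bar>(Q *v x) $ i * (Q *v x) $ j\<bar> \<le> 1 * exp ((2 * L) * norm x)" for x
    using mult_mono[OF comp[of x i] comp[of x j]] by (simp add: abs_mult mult.assoc flip: exp_add)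
  from bound[OF this] show ?int2
    by (intro integrable_exp_norm_bound[OF c, of _ "C * 1" "2 * L"]) (auto simp: mult.assoc)
  have shift: "integrable lborel (\<lambda>x. f x * gauss Q (x - h))" for h
  proof -
    have "\<bar>exp (h \<bullet> (Q *v x) - h \<bullet> (Q *v h) / 2)\<bar> \<le> 1 * exp ((norm h * L) * norm x)" for x
    proof -
      have "h \<bullet> (Q *v x) \<le> norm h * (L * norm x)"
        using norm_cauchy_schwarz[of h "Q *v x"] mult_left_mono[OF L(2)[of x], of "norm h"] by simp
      then show ?thesis
        using pos_def_nonneg[OF Q, of h] by simp
    qed
    from bound[OF this] show ?thesis
      unfolding gauss_shift[OF Q]
      by (intro integrable_exp_norm_bound[OF c, of _ "C * 1" "norm h * L"]) (auto simp: ac_simps)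
  qed
  \<comment> \<open>Second difference of the Gaussian with backward shifts. By translation
    invariance its integral against f is that of the forward second difference of f against the
    Gaussian.\<close>
  define E where "E = (\<lambda>e x. gauss Q (x - axis i e - axis j e) - gauss Q (x - axis i e)
      - gauss Q (x - axis j e) + gauss Q x)"
  have shift': "integrable lborel (\<lambda>x. f (h + x) * gauss Q x)"
    "(\<integral>x. f x * gauss Q (x - h) \<partial>lborel) = (\<integral>x. f (h + x) * gauss Q x \<partial>lborel)" for h
    using integrable_lborel_translate[OF shift, of h h] by simp_all
  have E_nonneg: "0 \<le> (\<integral>x. f x * E e x \<partial>lborel)" if e: "e > 0" for e
  proof -
    have "0 \<le> (\<integral>x. (f (axis i e + axis j e + x) - f (axis i e + x) - f (axis j e + x) + f (0 + x)) * gauss Q x \<partial>lborel)"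
    proof (rule Bochner_Integration.integral_nonneg)
      fix x
      have "f (x + axis i e) + f (x + axis j e) \<le> f (x + axis i e + axis j e) + f x"
        using e by (intro dcx_funD[OF f]) (auto simp: less_eq_vec_def axis_def)
      then show "0 \<le> (f (axis i e + axis j e + x) - f (axis i e + x) - f (axis j e + x) + f (0 + x)) * gauss Q x"
        by (intro mult_nonneg_nonneg) (auto simp: ac_simps)
    qed
    also have "\<dots> = (\<integral>x. f (axis i e + axis j e + x) * gauss Q x - f (axis i e + x) * gauss Q x -
        f (axis j e + x) * gauss Q x + f (0 + x) * gauss Q x \<partial>lborel)"
      by (simp add: algebra_simps)
    also have "\<dots> = (\<integral>x. f x * gauss Q (x - (axis i e + axis j e)) - f x * gauss Q (x - axis i e) -
        f x * gauss Q (x - axis j e) + f x * gauss Q (x - 0) \<partial>lborel)"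
      by (simp only: Bochner_Integration.integral_add Bochner_Integration.integral_diff
          Bochner_Integration.integrable_diff shift shift')
    also have "\<dots> = (\<integral>x. f x * E e x \<partial>lborel)"
      by (simp add: E_def algebra_simps)
    finally show ?thesis .
  qed
  define e where "e = (\<lambda>n. 1 / real (Suc n))"
  have e: "0 < e n" "e n \<le> 1" for n
    by (auto simp: e_def)
  have e0: "e \<longlonglongrightarrow> 0"
    using LIMSEQ_inverse_real_of_nat by (simp add: e_def inverse_eq_divide)
  have e_neq: "e n \<noteq> 0" for n
    using e(1)[of n] by simp
  with e0 have e0': "filterlim e (at 0) sequentially"
    by (simp add: filterlim_at)
  have e2: "filterlim (\<lambda>n. (e n)\<^sup>2) (at 0) sequentially"
    using tendsto_power[OF e0, of 2] e_neq by (simp add: filterlim_at)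
  define A where "A = (\<lambda>k e x. exp (e * (Q *v x) $ k - e\<^sup>2 * Q $ k $ k / 2))"
  \<comment> \<open>Regrouped so that both summands are of order e^2: a product of two first
    differences, and the cross term produced by \<open>Q $ i $ j\<close>.\<close>
  have E_eq: "E e x = gauss Q x * ((A i e x - 1) * (A j e x - 1) +
      A i e x * A j e x * (exp (- (e\<^sup>2 * Q $ i $ j)) - 1))" for e x
  proof -
    have ax: "axis k e = e *\<^sub>R axis k 1" for k :: 'm
      by (simp add: vec_eq_iff axis_def)
    have q: "axis k e \<bullet> (Q *v x) = e * (Q *v x) $ k" for k x
      unfolding ax by (simp add: inner_axis')
    have q1: "axis k e \<bullet> (Q *v axis l e) = e\<^sup>2 * Q $ k $ l" for k l
      unfolding q by (simp add: ax matrix_vector_mult_scaleR matrix_vector_mul_component inner_axis power2_eq_square)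
    have A: "gauss Q (x - axis k e) = gauss Q x * A k e x" for k
      unfolding gauss_shift[OF Q] q1 by (simp add: q A_def)
    have "gauss Q (x - axis i e - axis j e) = gauss Q x * (A i e x * A j e x * exp (- (e\<^sup>2 * Q $ i $ j)))"
      unfolding gauss_shift[OF Q] matrix_vector_mult_diff_distrib inner_diff_right q1 A_def
      unfolding q pos_def_entry_sym[OF Q, of j i] mult.assoc mult_exp_exp
      by (simp add: algebra_simps)
    with A show ?thesis
      unfolding E_def by (simp add: algebra_simps)
  qed
  have lim: "(\<lambda>n. f x * (E (e n) x / (e n)\<^sup>2)) \<longlonglongrightarrow> f x * (gauss Q x * ((Q *v x) $ i * (Q *v x) $ j - Q $ i $ j))" for x
  proof -
    have A1: "(\<lambda>n. (A k (e n) x - 1) / e n) \<longlonglongrightarrow> (Q *v x) $ k" for k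
    proof -
      have "((\<lambda>e. A k e x) has_real_derivative (Q *v x) $ k) (at 0)"
        unfolding A_def by (auto intro!: derivative_eq_intros)
      then have "((\<lambda>e. (A k e x - 1) / e) \<longlongrightarrow> (Q *v x) $ k) (at 0)"
        unfolding has_field_derivative_iff by (simp add: A_def)
      from filterlim_compose[OF this e0'] show ?thesis .
    qed
    have A2: "(\<lambda>n. A k (e n) x) \<longlonglongrightarrow> 1" for k
      unfolding A_def by (rule tendsto_eq_intros e0 | simp)+
    have "((\<lambda>t. exp (- (t * Q $ i $ j))) has_real_derivative - (Q $ i $ j)) (at 0)"
      by (auto intro!: derivative_eq_intros)
    then have "((\<lambda>t. (exp (- (t * Q $ i $ j)) - 1) / t) \<longlongrightarrow> - (Q $ i $ j)) (at 0)"
      unfolding has_field_derivative_iff by simp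
    from filterlim_compose[OF this e2]
    have A3: "(\<lambda>n. (exp (- ((e n)\<^sup>2 * Q $ i $ j)) - 1) / (e n)\<^sup>2) \<longlonglongrightarrow> - (Q $ i $ j)" .
    have "(\<lambda>n. f x * (gauss Q x * ((A i (e n) x - 1) / e n * ((A j (e n) x - 1) / e n) +
        A i (e n) x * A j (e n) x * ((exp (- ((e n)\<^sup>2 * Q $ i $ j)) - 1) / (e n)\<^sup>2))))
      \<longlonglongrightarrow> f x * (gauss Q x * ((Q *v x) $ i * (Q *v x) $ j + 1 * 1 * - (Q $ i $ j)))"
      by (intro tendsto_intros A1 A2 A3)
    moreover have "gauss Q x * ((A i (e n) x - 1) / e n * ((A j (e n) x - 1) / e n) +
        A i (e n) x * A j (e n) x * ((exp (- ((e n)\<^sup>2 * Q $ i $ j)) - 1) / (e n)\<^sup>2)) = E (e n) x / (e n)\<^sup>2" for n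
      unfolding E_eq times_divide_eq_right[symmetric] add_divide_distrib by (simp add: power2_eq_square)
    ultimately show ?thesis by simp
  qed
  have dom: "\<bar>f x * (E (e n) x / (e n)\<^sup>2)\<bar> \<le> (C * (2 * exp (4 * L))) * exp ((4 * L) * norm x - c * (norm x)\<^sup>2)" for n x
  proof -
    let ?e = "e n"
    \<comment> \<open>Bounds the exponent of each shift for all steps at most 1. Difference
      quotients are at most \<open>exp (2 * p)\<close> and the products at most
      \<open>exp (4 * p)\<close>, whence the rate \<open>4 * L\<close>.\<close>
    define p where "p = L * norm x + L"
    have p0: "0 \<le> p" using L(1) by (simp add: p_def)
    have arg: "\<bar>?e * (Q *v x) $ k - ?e\<^sup>2 * Q $ k $ k / 2\<bar> \<le> ?e * p" for k
    proof -
      have "\<bar>?e * (Q *v x) $ k\<bar> \<le> ?e * (L * norm x)"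
        using e[of n] L(3)[of x k] by (simp add: abs_mult)
      moreover have "\<bar>?e\<^sup>2 * Q $ k $ k / 2\<bar> \<le> ?e * L"
      proof -
        have "\<bar>Q $ k $ k\<bar> / 2 \<le> L" using L(4)[of k k] L(1) by linarith
        moreover have "?e\<^sup>2 \<le> ?e" using e[of n] by (simp add: power2_eq_square mult_left_le)
        ultimately have "?e\<^sup>2 * (\<bar>Q $ k $ k\<bar> / 2) \<le> ?e * L"
          using e[of n] L(1) by (intro mult_mono) auto
        then show ?thesis by (simp add: abs_mult)
      qed
      ultimately show ?thesis
        using abs_triangle_ineq4[of "?e * (Q *v x) $ k" "?e\<^sup>2 * Q $ k $ k / 2"] by (simp add: p_def algebra_simps)
    qed
    have ep: "?e * p \<le> p" using e[of n] p0 by (simp add: mult_left_le_one_le)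
    have Ab: "\<bar>A k ?e x\<bar> \<le> exp p" for k
      unfolding A_def using arg[of k] ep by simp
    have A1b: "\<bar>(A k ?e x - 1) / ?e\<bar> \<le> exp (2 * p)" for k
    proof -
      have "\<bar>A k ?e x - 1\<bar> \<le> (?e * p) * exp p"
        unfolding A_def using arg[of k] ep p0 e[of n]
        by (intro order_trans[OF abs_exp_minus_one_le] mult_mono) auto
      also have "\<dots> \<le> (?e * exp p) * exp p"
        using e[of n] by (intro mult_right_mono mult_left_mono lin_exp) auto
      also have "\<dots> = exp (2 * p) * ?e"
        by (simp add: mult_exp_exp)
      finally show ?thesis
        using e[of n] by (simp add: divide_le_eq)
    qed
    have A3b: "\<bar>(exp (- (?e\<^sup>2 * Q $ i $ j)) - 1) / ?e\<^sup>2\<bar> \<le> exp (2 * p)"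
    proof -
      have e2: "?e\<^sup>2 \<le> 1" using e[of n] by (simp add: power_le_one)
      have q: "\<bar>Q $ i $ j\<bar> \<le> p" using L(1) L(4)[of i j] by (simp add: p_def add_increasing)
      then have "\<bar>- (?e\<^sup>2 * Q $ i $ j)\<bar> \<le> ?e\<^sup>2 * p"
        by (simp add: abs_mult mult_left_mono)
      moreover have "?e\<^sup>2 * p \<le> p" using e2 p0 by (simp add: mult_left_le_one_le)
      ultimately have "\<bar>exp (- (?e\<^sup>2 * Q $ i $ j)) - 1\<bar> \<le> (?e\<^sup>2 * p) * exp p"
        using p0 by (intro order_trans[OF abs_exp_minus_one_le] mult_mono) auto
      also have "\<dots> \<le> (?e\<^sup>2 * exp p) * exp p"
        by (intro mult_right_mono mult_left_mono lin_exp) auto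
      also have "\<dots> = exp (2 * p) * ?e\<^sup>2"
        by (simp add: mult_exp_exp)
      finally show ?thesis
        using e_neq[of n] by (simp add: divide_le_eq)
    qed
    define g where "g = (A i ?e x - 1) / ?e * ((A j ?e x - 1) / ?e) +
        A i ?e x * A j ?e x * ((exp (- (?e\<^sup>2 * Q $ i $ j)) - 1) / ?e\<^sup>2)"
    have "\<bar>g\<bar> \<le> exp (2 * p) * exp (2 * p) + exp p * exp p * exp (2 * p)"
      unfolding g_def
      by (rule order_trans[OF abs_triangle_ineq], unfold abs_mult, intro add_mono mult_mono A1b Ab A3b) auto
    also have "\<dots> = 2 * exp (4 * L) * exp (4 * L * norm x)"
      by (simp add: mult_exp_exp p_def algebra_simps)
    finally have "\<bar>f x * g * gauss Q x\<bar> \<le> (C * (2 * exp (4 * L))) * exp ((4 * L) * norm x - c * (norm x)\<^sup>2)"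
      by (rule bound)
    moreover have "f x * g * gauss Q x = f x * (E ?e x / ?e\<^sup>2)"
      unfolding E_eq g_def times_divide_eq_right[symmetric] add_divide_distrib
      by (simp add: power2_eq_square)
    ultimately show ?thesis by simp
  qed
  have [measurable]: "E t \<in> borel_measurable borel" for t
    unfolding E_def by measurable
  have "(\<lambda>n. \<integral>x. f x * (E (e n) x / (e n)\<^sup>2) \<partial>lborel) \<longlonglongrightarrow>
      (\<integral>x. f x * (gauss Q x * ((Q *v x) $ i * (Q *v x) $ j - Q $ i $ j)) \<partial>lborel)"
  proof (rule integral_dominated_convergence)
    show "integrable lborel (\<lambda>x::real^'m. (C * (2 * exp (4 * L))) * exp ((4 * L) * norm x - c * (norm x)\<^sup>2))"
      using c by (intro integrable_mult_right integrable_exp_norm)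
  qed (use lim dom in auto)
  moreover have "0 \<le> (\<integral>x. f x * (E (e n) x / (e n)\<^sup>2) \<partial>lborel)" for n
    using E_nonneg[OF e(1), of n] by simp
  ultimately have "0 \<le> (\<integral>x. f x * (gauss Q x * ((Q *v x) $ i * (Q *v x) $ j - Q $ i $ j)) \<partial>lborel)"
    by (intro LIMSEQ_le_const) auto
  also have "\<dots> = (\<integral>x. f x * (Q *v x) $ i * (Q *v x) $ j * gauss Q x - Q $ i $ j * (f x * gauss Q x) \<partial>lborel)"
    by (simp add: algebra_simps)
  also have "\<dots> = (\<integral>x. f x * (Q *v x) $ i * (Q *v x) $ j * gauss Q x \<partial>lborel) - Q $ i $ j * (\<integral>x. f x * gauss Q x \<partial>lborel)"
    using \<open>?int0\<close> \<open>?int2\<close> by (subst Bochner_Integration.integral_diff) auto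
  finally show ?le by simp
qed

section \<open>Interpolation between two covariance matrices\<close>

text \<open>Linear in the covariance, so that the path has the constant direction
  \<open>T - S\<close>, whose entries are nonnegative in the application.\<close>

definition precision_path :: "real^'m^'m \<Rightarrow> real^'m^'m \<Rightarrow> real \<Rightarrow> real^'m^'m" where
  "precision_path S T r = matrix_inv ((1 - r) *\<^sub>R S + r *\<^sub>R T)"

lemma precision_path_0 [simp]: "precision_path S T 0 = matrix_inv S"
  and precision_path_1 [simp]: "precision_path S T 1 = matrix_inv T"
  by (simp_all add: precision_path_def)

lemma scaleR_matrix_vector: "(c *\<^sub>R A) *v x = c *\<^sub>R (A *v x)" for A :: "real^'n^'m"
  by (rule scaleR_matrix_vector_assoc[symmetric])

lemma pos_def_segment:
  fixes S T :: "real^'m^'m"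
  assumes "pos_def S" "pos_def T" "r \<in> {0..1}"
  shows "pos_def ((1 - r) *\<^sub>R S + r *\<^sub>R T)"
proof (cases "r = 0 \<or> r = 1")
  case False
  with assms show ?thesis
    by (intro pos_def_add pos_def_scaleR) auto
qed (use assms in auto)

lemma pos_def_precision_path:
  "pos_def S \<Longrightarrow> pos_def T \<Longrightarrow> r \<in> {0..1} \<Longrightarrow> pos_def (precision_path S T r)"
  unfolding precision_path_def by (intro pos_def_matrix_inv pos_def_segment)

text \<open>Uniform bounds without continuity of inversion: the dual Cauchy-Schwarz inequality at
  the pair x, x gives the lower one, and inserting Q x into the lower bound for the covariance gives
  the upper one.\<close>

lemma precision_path_bounds:
  fixes S T :: "real^'m^'m"
  assumes S: "pos_def S" and T: "pos_def T"
  obtains c L where "c > 0" "L > 0"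
    "\<And>r x. r \<in> {0..1} \<Longrightarrow> c * (norm x)\<^sup>2 \<le> x \<bullet> (precision_path S T r *v x)"
    "\<And>r x. r \<in> {0..1} \<Longrightarrow> norm (precision_path S T r *v x) \<le> L * norm x"
proof -
  let ?P = "\<lambda>r. (1 - r) *\<^sub>R S + r *\<^sub>R T" and ?Q = "precision_path S T"
  obtain U V where U: "U > 0" "\<And>x. x \<bullet> (S *v x) \<le> U * (norm x)\<^sup>2"
    and V: "V > 0" "\<And>x. x \<bullet> (T *v x) \<le> V * (norm x)\<^sup>2"
    using quad_form_upper[of S] quad_form_upper[of T] by metis
  obtain u v where u: "u > 0" "\<And>x. u * (norm x)\<^sup>2 \<le> x \<bullet> (S *v x)"
    and v: "v > 0" "\<And>x. v * (norm x)\<^sup>2 \<le> x \<bullet> (T *v x)"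
    using quad_form_lower[OF S] quad_form_lower[OF T] by metis
  have quad: "x \<bullet> (?P r *v x) = (1 - r) * (x \<bullet> (S *v x)) + r * (x \<bullet> (T *v x))" for r x
    by (simp add: matrix_vector_mult_add_rdistrib scaleR_matrix_vector inner_add_right)
  have up: "x \<bullet> (?P r *v x) \<le> (U + V) * (norm x)\<^sup>2" if "r \<in> {0..1}" for r x
  proof -
    have "(1 - r) * (x \<bullet> (S *v x)) \<le> 1 * (U * (norm x)\<^sup>2)"
      using that by (intro mult_mono U) (auto simp: pos_def_nonneg[OF S])
    moreover have "r * (x \<bullet> (T *v x)) \<le> 1 * (V * (norm x)\<^sup>2)"
      using that by (intro mult_mono V) (auto simp: pos_def_nonneg[OF T])
    ultimately show ?thesis unfolding quad by (simp add: distrib_right)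
  qed
  define m where "m = min u v"
  have m: "m > 0" using u v by (simp add: m_def)
  have low: "m * (norm x)\<^sup>2 \<le> x \<bullet> (?P r *v x)" if "r \<in> {0..1}" for r x
  proof -
    have "m * (norm x)\<^sup>2 \<le> x \<bullet> (S *v x)" "m * (norm x)\<^sup>2 \<le> x \<bullet> (T *v x)"
      using u(2)[of x] v(2)[of x] mult_right_mono[of m u "(norm x)\<^sup>2"] mult_right_mono[of m v "(norm x)\<^sup>2"]
      by (auto simp: m_def)
    then have "(1 - r) * (m * (norm x)\<^sup>2) + r * (m * (norm x)\<^sup>2) \<le> x \<bullet> (?P r *v x)"
      unfolding quad using that by (intro add_mono mult_left_mono) auto
    then show ?thesis by (simp add: algebra_simps)
  qed
  show ?thesis
  proof
    show "0 < 1 / (U + V)" "0 < 1 / m" using U V m by auto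
  next
    fix r :: real and x :: "real^'m"
    assume r: "r \<in> {0..1}"
    note P = pos_def_segment[OF S T r]
    have "((norm x)\<^sup>2)\<^sup>2 \<le> (x \<bullet> (?Q r *v x)) * (x \<bullet> (?P r *v x))"
      using pos_def_cauchy_dual[OF P, of x x] by (simp add: precision_path_def power2_norm_eq_inner)
    also have "\<dots> \<le> (x \<bullet> (?Q r *v x)) * ((U + V) * (norm x)\<^sup>2)"
      using r by (intro mult_left_mono up pos_def_nonneg pos_def_precision_path S T)
    finally have *: "(norm x)\<^sup>2 * (norm x)\<^sup>2 \<le> ((x \<bullet> (?Q r *v x)) * (U + V)) * (norm x)\<^sup>2"
      by (simp add: power2_eq_square ac_simps)
    have "(norm x)\<^sup>2 \<le> (x \<bullet> (?Q r *v x)) * (U + V)"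
    proof (cases "x = 0")
      case False
      then show ?thesis using mult_right_le_imp_le[OF *] by simp
    qed simp
    then show "1 / (U + V) * (norm x)\<^sup>2 \<le> x \<bullet> (?Q r *v x)"
      using U V by (simp add: field_simps)
    have "m * (norm (?Q r *v x))\<^sup>2 \<le> (?Q r *v x) \<bullet> x"
      using low[OF r, of "?Q r *v x"]
      by (simp add: precision_path_def pos_def_inverse_vector[OF P])
    also have "\<dots> \<le> norm (?Q r *v x) * norm x"
      by (rule norm_cauchy_schwarz)
    finally have "(m * norm (?Q r *v x)) * norm (?Q r *v x) \<le> norm x * norm (?Q r *v x)"
      by (simp add: power2_eq_square ac_simps)
    then have "m * norm (?Q r *v x) \<le> norm x"
      by (cases "?Q r *v x = 0") (auto simp: mult_le_cancel_right)
    then show "norm (?Q r *v x) \<le> 1 / m * norm x"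
      using m by (simp add: field_simps)
  qed
qed

text \<open>Resolvent identity Q_s - Q_r = Q_r (P_r - P_s) Q_s for the covariances P. It replaces
  differentiation of the matrix inverse.\<close>

lemma precision_path_diff:
  fixes S T :: "real^'m^'m"
  assumes "pos_def S" "pos_def T" "r \<in> {0..1}" "s \<in> {0..1}"
  shows "precision_path S T s *v x - precision_path S T r *v x =
    (r - s) *\<^sub>R (precision_path S T r *v ((T - S) *v (precision_path S T s *v x)))"
proof -
  let ?P = "\<lambda>r. (1 - r) *\<^sub>R S + r *\<^sub>R T" and ?Q = "precision_path S T"
  have "?P r = ?P s + (r - s) *\<^sub>R (T - S)"
    by (simp add: algebra_simps)
  then have "?P r *v (?Q s *v x) = x + (r - s) *\<^sub>R ((T - S) *v (?Q s *v x))"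
    using pos_def_inverse_vector(1)[OF pos_def_segment[OF assms(1,2,4)], of x]
    by (simp only: matrix_vector_mult_add_rdistrib scaleR_matrix_vector precision_path_def)
  then have "?Q r *v (?P r *v (?Q s *v x)) = ?Q r *v x + (r - s) *\<^sub>R (?Q r *v ((T - S) *v (?Q s *v x)))"
    by (simp only: matrix_vector_right_distrib matrix_vector_mult_scaleR)
  moreover have "?Q r *v (?P r *v y) = y" for y
    using pos_def_inverse_vector(2)[OF pos_def_segment[OF assms(1,2,3)], of y]
    by (simp only: precision_path_def)
  ultimately show ?thesis by (metis add_diff_cancel_left')
qed

lemma precision_path_quad_diff:
  fixes S T :: "real^'m^'m"
  assumes "pos_def S" "pos_def T" "r \<in> {0..1}" "s \<in> {0..1}"
  shows "x \<bullet> (precision_path S T s *v x) - x \<bullet> (precision_path S T r *v x) =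
    (r - s) * ((precision_path S T r *v x) \<bullet> ((T - S) *v (precision_path S T s *v x)))"
  unfolding inner_diff_right[symmetric] precision_path_diff[OF assms]
  by (simp add: pos_def_inner[OF pos_def_precision_path[OF assms(1-3)]])

text \<open>The derivative of Q is -Q (T - S) Q, so the exponent contributes (Q x)^T (T - S) (Q x) /
  2. A growth bound along the whole path with b < 1 provides one majorant for all difference
  quotients.\<close>

lemma gauss_integral_derivative:
  fixes S T :: "real^'m^'m" and f :: "real^'m \<Rightarrow> real"
  defines "Q \<equiv> precision_path S T"
  assumes S: "pos_def S" and T: "pos_def T" and [measurable]: "f \<in> borel_measurable borel"
    and b: "b < 1" and C: "\<And>r x. r \<in> {0..1} \<Longrightarrow> \<bar>f x\<bar> \<le> C * exp (b * (x \<bullet> (Q r *v x)) / 2)"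
    and r: "r \<in> {0..1}"
  shows "((\<lambda>r. \<integral>x. f x * gauss (Q r) x \<partial>lborel) has_real_derivative
    (\<integral>x. f x * ((Q r *v x) \<bullet> ((T - S) *v (Q r *v x)) / 2) * gauss (Q r) x \<partial>lborel)) (at r within {0..1})"
  unfolding has_field_derivative_iff tendsto_at_iff_sequentially
proof (intro allI impI)
  fix X :: "nat \<Rightarrow> real"
  assume X: "\<forall>i. X i \<in> {0..1} - {r}" and lim: "X \<longlonglongrightarrow> r"
  have X01: "X i \<in> {0..1}" and Xr: "X i \<noteq> r" for i
    using X by auto
  obtain c0 L where c0: "c0 > 0" and L: "L > 0"
    and low: "\<And>r x. r \<in> {0..1} \<Longrightarrow> c0 * (norm x)\<^sup>2 \<le> x \<bullet> (Q r *v x)"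
    and up: "\<And>r x. r \<in> {0..1} \<Longrightarrow> norm (Q r *v x) \<le> L * norm x"
    using precision_path_bounds[OF S T] unfolding Q_def by blast
  obtain K where K: "K > 0" "\<And>x. norm ((T - S) *v x) \<le> K * norm x"
    using linear_bounded_pos[OF matrix_vector_mul_linear[of "T - S"]] by blast
  define c where "c = (1 - b) * c0 / 2"
  have c: "c > 0" using b c0 by (simp add: c_def)
  have C0: "0 \<le> C" using C[of 0 0] by simp
  have fg: "\<bar>f x\<bar> * gauss (Q s) x \<le> C * exp (- (c * (norm x)\<^sup>2))" if s: "s \<in> {0..1}" for s x
  proof -
    have "(1 - b) / 2 * (c0 * (norm x)\<^sup>2) \<le> (1 - b) / 2 * (x \<bullet> (Q s *v x))"
      using b s by (intro mult_left_mono low) auto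
    then have "b * (x \<bullet> (Q s *v x)) / 2 + - (x \<bullet> (Q s *v x)) / 2 \<le> - (c * (norm x)\<^sup>2)"
      by (simp add: c_def field_simps)
    then have "exp (b * (x \<bullet> (Q s *v x)) / 2) * gauss (Q s) x \<le> exp (- (c * (norm x)\<^sup>2))"
      unfolding gauss_def by (simp flip: exp_add)
    from mult_left_mono[OF this C0] order_trans[OF mult_right_mono[OF C[OF s, of x] gauss_nonneg[of "Q s" x]]]
    show ?thesis by simp
  qed
  have int: "integrable lborel (\<lambda>x. f x * gauss (Q s) x)" if "s \<in> {0..1}" for s
    using fg[OF that] by (intro integrable_exp_norm_bound[OF c, of _ C 0]) (auto simp: abs_mult)
  \<comment> \<open>By the resolvent identity the exponent changes by exactly
    \<open>(s - r) * w s x / 2\<close>.\<close>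
  define w where "w = (\<lambda>s x. (Q r *v x) \<bullet> ((T - S) *v (Q s *v x)))"
  have quad: "x \<bullet> (Q s *v x) - x \<bullet> (Q r *v x) = (r - s) * w s x" if "s \<in> {0..1}" for s x
    unfolding w_def Q_def by (rule precision_path_quad_diff[OF S T r that])
  have wb: "\<bar>w s x\<bar> \<le> L * K * L * (norm x)\<^sup>2" if s: "s \<in> {0..1}" for s x
  proof -
    have "\<bar>w s x\<bar> \<le> norm (Q r *v x) * norm ((T - S) *v (Q s *v x))"
      unfolding w_def by (rule Cauchy_Schwarz_ineq2)
    also have "\<dots> \<le> (L * norm x) * (K * (L * norm x))"
      using K(1) L by (intro mult_mono up r order_trans[OF K(2)] mult_left_mono s) auto
    finally show ?thesis by (simp add: power2_eq_square ac_simps)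
  qed
  let ?q = "\<lambda>s x. (gauss (Q s) x - gauss (Q r) x) / (s - r)"
  have wlim: "(\<lambda>i. w (X i) x) \<longlonglongrightarrow> w r x" for x
  proof -
    have "(\<lambda>i. Q (X i) *v x) \<longlonglongrightarrow> Q r *v x"
    proof (rule LIM_zero_cancel, rule Lim_null_comparison)
      show "\<forall>\<^sub>F i in sequentially. norm (Q (X i) *v x - Q r *v x) \<le> \<bar>X i - r\<bar> * (L * (K * (L * norm x)))"
      proof (rule always_eventually, rule allI)
        fix i
        have "norm (Q r *v ((T - S) *v (Q (X i) *v x))) \<le> L * (K * (L * norm x))"
          using L K(1) by (intro order_trans[OF up[OF r]] mult_left_mono order_trans[OF K(2)] up X01) auto
        then show "norm (Q (X i) *v x - Q r *v x) \<le> \<bar>X i - r\<bar> * (L * (K * (L * norm x)))"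
          unfolding Q_def precision_path_diff[OF S T r X01]
          by (simp add: mult_left_mono abs_minus_commute)
      qed
      show "(\<lambda>i. \<bar>X i - r\<bar> * (L * (K * (L * norm x)))) \<longlonglongrightarrow> 0"
        using lim by (intro tendsto_mult_left_zero tendsto_rabs_zero) (rule LIM_zero)
    qed
    then show ?thesis
      unfolding w_def by (intro tendsto_intros bounded_linear.tendsto[OF matrix_vector_mul_bounded_linear])
  qed
  \<comment> \<open>The difference quotient of exp at 0 with its singularity filled in, since the
    increment vanishes whenever w does.\<close>
  define phi where "phi = (\<lambda>d::real. if d = 0 then 1 else (exp d - 1) / d)"
  have phi: "exp d - 1 = d * phi d" for d
    by (simp add: phi_def)
  have "((\<lambda>d. (exp (0 + d) - exp 0) / d) \<longlongrightarrow> exp (0::real)) (at 0)"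
    using DERIV_exp[of "0::real"] unfolding DERIV_def .
  moreover have "(phi \<longlongrightarrow> 1) (at 0) \<longleftrightarrow> ((\<lambda>d. (exp (0 + d) - exp 0) / d) \<longlongrightarrow> 1) (at (0::real))"
    by (rule LIM_equal) (simp add: phi_def)
  ultimately have "(phi \<longlongrightarrow> 1) (at 0)"
    by simp
  then have "isCont phi 0"
    by (simp add: isCont_def phi_def)
  then have phi_lim: "(\<lambda>i. phi (d i)) \<longlonglongrightarrow> 1" if "d \<longlonglongrightarrow> 0" for d :: "nat \<Rightarrow> real"
    using isCont_tendsto_compose[OF _ that, of phi] by (simp add: phi_def)
  have qlim: "(\<lambda>i. f x * ?q (X i) x) \<longlonglongrightarrow> f x * (w r x / 2) * gauss (Q r) x" for x
  proof -
    let ?d = "\<lambda>i. (X i - r) * (w (X i) x / 2)"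
    have eq: "?q (X i) x = gauss (Q r) x * (w (X i) x / 2) * phi (?d i)" for i
    proof -
      have "- (x \<bullet> (Q (X i) *v x)) / 2 = - (x \<bullet> (Q r *v x)) / 2 + ?d i"
        using quad[OF X01[of i], of x] by (simp add: field_simps)
      then have "gauss (Q (X i)) x = gauss (Q r) x * exp (?d i)"
        unfolding gauss_def by (metis exp_add)
      then have "gauss (Q (X i)) x - gauss (Q r) x = gauss (Q r) x * (?d i * phi (?d i))"
        unfolding phi[symmetric] by (simp add: right_diff_distrib)
      then show ?thesis using Xr[of i] by simp
    qed
    have "?d \<longlonglongrightarrow> 0 * (w r x / 2)"
      using lim by (intro tendsto_intros wlim) (auto intro: LIM_zero)
    then have "(\<lambda>i. f x * (gauss (Q r) x * (w (X i) x / 2) * phi (?d i))) \<longlonglongrightarrow>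
        f x * (gauss (Q r) x * (w r x / 2) * 1)"
      by (intro tendsto_intros wlim phi_lim) auto
    then show ?thesis unfolding eq by (simp add: ac_simps)
  qed
  \<comment> \<open>The factor \<open>X i - r\<close> cancels, leaving a squared norm that
    \<open>exp (2 * norm x)\<close> dominates.\<close>
  have dom: "\<bar>f x * ?q (X i) x\<bar> \<le> (L * K * L * C) * exp (2 * norm x - c * (norm x)\<^sup>2)" for i x
  proof -
    let ?a = "\<lambda>s. - (x \<bullet> (Q s *v x)) / 2"
    have "\<bar>?a (X i) - ?a r\<bar> = \<bar>X i - r\<bar> * (\<bar>w (X i) x\<bar> / 2)"
      using quad[OF X01[of i], of x] by (simp add: abs_minus_commute flip: abs_mult) (simp add: field_simps)
    also have "\<dots> \<le> \<bar>X i - r\<bar> * (L * K * L * (norm x)\<^sup>2 / 2)"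
      by (intro mult_left_mono divide_right_mono wb X01) auto
    finally have "\<bar>gauss (Q (X i)) x - gauss (Q r) x\<bar> \<le>
        \<bar>X i - r\<bar> * (L * K * L * (norm x)\<^sup>2 / 2) * (gauss (Q (X i)) x + gauss (Q r) x)"
      unfolding gauss_def by (intro order_trans[OF abs_exp_diff_le] mult_right_mono) auto
    then have "\<bar>?q (X i) x\<bar> \<le> (L * K * L * (norm x)\<^sup>2 / 2) * (gauss (Q (X i)) x + gauss (Q r) x)"
      using Xr[of i] by (simp add: divide_le_eq ac_simps)
    from mult_left_mono[OF this abs_ge_zero[of "f x"]]
    have "\<bar>f x * ?q (X i) x\<bar> \<le>
        \<bar>f x\<bar> * ((L * K * L * (norm x)\<^sup>2 / 2) * (gauss (Q (X i)) x + gauss (Q r) x))"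
      by (simp only: abs_mult)
    also have "\<dots> =
        (L * K * L * (norm x)\<^sup>2 / 2) * (\<bar>f x\<bar> * gauss (Q (X i)) x + \<bar>f x\<bar> * gauss (Q r) x)"
      by (simp only: distrib_left mult.left_commute)
    also have "\<dots> \<le> (L * K * L * (norm x)\<^sup>2 / 2) * (C * exp (- (c * (norm x)\<^sup>2)) + C * exp (- (c * (norm x)\<^sup>2)))"
      using L K(1) by (intro mult_left_mono add_mono fg X01 r) auto
    also have "\<dots> = (L * K * L * C) * ((norm x)\<^sup>2 * exp (- (c * (norm x)\<^sup>2)))"
      by simp
    also have "\<dots> \<le> (L * K * L * C) * (exp (2 * norm x) * exp (- (c * (norm x)\<^sup>2)))"
    proof (intro mult_left_mono mult_right_mono)
      have "norm x \<le> exp (norm x)"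
        using exp_ge_add_one_self[of "norm x"] by linarith
      then have "norm x * norm x \<le> exp (norm x) * exp (norm x)"
        by (intro mult_mono) auto
      then show "(norm x)\<^sup>2 \<le> exp (2 * norm x)"
        by (simp add: power2_eq_square mult_exp_exp)
    qed (use L K C0 in auto)
    also have "\<dots> = (L * K * L * C) * exp (2 * norm x - c * (norm x)\<^sup>2)"
      by (simp add: mult_exp_exp)
    finally show ?thesis .
  qed
  have [measurable]: "w s \<in> borel_measurable borel" for s
    unfolding w_def by measurable
  have "(\<lambda>i. \<integral>x. f x * ?q (X i) x \<partial>lborel) \<longlonglongrightarrow> (\<integral>x. f x * (w r x / 2) * gauss (Q r) x \<partial>lborel)"
  proof (rule integral_dominated_convergence)
    show "integrable lborel (\<lambda>x::real^'m. (L * K * L * C) * exp (2 * norm x - c * (norm x)\<^sup>2))"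
      using c by (intro integrable_mult_right integrable_exp_norm)
  qed (use qlim dom in auto)
  moreover have diff_quot: "(\<integral>x. f x * ?q (X i) x \<partial>lborel) =
      ((\<integral>x. f x * gauss (Q (X i)) x \<partial>lborel) - (\<integral>x. f x * gauss (Q r) x \<partial>lborel)) / (X i - r)" for i
    using Bochner_Integration.integral_diff[OF int[OF X01[of i]] int[OF r]]
    by (simp add: right_diff_distrib)
  ultimately show "((\<lambda>y. ((\<integral>x. f x * gauss (Q y) x \<partial>lborel) - (\<integral>x. f x * gauss (Q r) x \<partial>lborel)) / (y - r)) \<circ> X)
    \<longlonglongrightarrow> (\<integral>x. f x * ((Q r *v x) \<bullet> ((T - S) *v (Q r *v x)) / 2) * gauss (Q r) x \<partial>lborel)"
    unfolding o_def w_def diff_quot by simp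
qed

section \<open>Monotonicity of normal means along the path\<close>

lemma dcx_fun_const: "dcx_fun (\<lambda>x. c)"
  by (simp add: dcx_fun_def)

text \<open>The second derivative inequality summed with the nonnegative weights
  \<open>D $ i $ j / 2\<close>. The factor on the left is half the trace of D Q.\<close>

lemma precision_form_dcx:
  fixes f :: "real^'m \<Rightarrow> real"
  assumes f: "dcx_fun f" and [measurable]: "f \<in> borel_measurable borel" and Q: "pos_def Q"
    and b: "b < 1" and C: "\<And>x. \<bar>f x\<bar> \<le> C * exp (b * (x \<bullet> (Q *v x)) / 2)" and D: "0 \<le> D"
  shows "(\<Sum>i\<in>UNIV. \<Sum>j\<in>UNIV. D $ i $ j * Q $ i $ j) / 2 * (\<integral>x. f x * gauss Q x \<partial>lborel) \<le>
    (\<integral>x. f x * ((Q *v x) \<bullet> (D *v (Q *v x)) / 2) * gauss Q x \<partial>lborel)"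
proof -
  note * = dcx_fun_gauss_second_derivative[OF f assms(2) Q b C]
  have "f x * (y \<bullet> (D *v y) / 2) * g = (\<Sum>i\<in>UNIV. \<Sum>j\<in>UNIV. (D $ i $ j / 2) * (f x * y $ i * y $ j * g))"
    for x and y :: "real^'m" and g
    by (simp add: inner_vec_def matrix_vector_mult_def sum_distrib_left sum_distrib_right sum_divide_distrib ac_simps)
  then have "(\<integral>x. f x * ((Q *v x) \<bullet> (D *v (Q *v x)) / 2) * gauss Q x \<partial>lborel) =
      (\<Sum>i\<in>UNIV. \<Sum>j\<in>UNIV. (D $ i $ j / 2) * (\<integral>x. f x * (Q *v x) $ i * (Q *v x) $ j * gauss Q x \<partial>lborel))"
    using *(2) by (simp only: Bochner_Integration.integral_sum Bochner_Integration.integrable_sum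
      integrable_mult_right integral_mult_right_zero)
  moreover have "(\<Sum>i\<in>UNIV. \<Sum>j\<in>UNIV. D $ i $ j * Q $ i $ j) / 2 * (\<integral>x. f x * gauss Q x \<partial>lborel) =
      (\<Sum>i\<in>UNIV. \<Sum>j\<in>UNIV. (D $ i $ j / 2) * (Q $ i $ j * (\<integral>x. f x * gauss Q x \<partial>lborel)))"
    by (simp add: sum_distrib_left sum_divide_distrib ac_simps)
  moreover have "(\<Sum>i\<in>UNIV. \<Sum>j\<in>UNIV. (D $ i $ j / 2) * (\<integral>x. f x * (Q *v x) $ i * (Q *v x) $ j * gauss Q x \<partial>lborel)) \<ge> (\<Sum>i\<in>UNIV. \<Sum>j\<in>UNIV. (D $ i $ j / 2) * (Q $ i $ j * (\<integral>x. f x * gauss Q x \<partial>lborel)))"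
    using D by (intro sum_mono mult_left_mono *(3)) (simp add: less_eq_vec_def)
  ultimately show ?thesis
    by simp
qed

lemma gauss_integral_pos:
  assumes "pos_def Q"
  shows "0 < (\<integral>x. gauss Q x \<partial>lborel)" "integrable lborel (gauss Q)"
proof -
  show int: "integrable lborel (gauss Q)"
    using dcx_fun_gauss_second_derivative(1)[OF dcx_fun_const[of 1] _ assms, of 0 1] by simp
  have "(\<integral>x. gauss Q x \<partial>lborel) \<noteq> 0"
  proof
    assume "(\<integral>x. gauss Q x \<partial>lborel) = 0"
    then have "AE x in lborel. gauss Q x = 0"
      using int by (subst (asm) integral_nonneg_eq_0_iff_AE) auto
    then have "AE x in (lborel :: (real^'a) measure). False"
      by (rule AE_mp) (auto intro!: AE_I2 simp: gauss_def)
    then have "emeasure lborel (UNIV :: (real^'a) set) = 0"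
      by (subst (asm) AE_iff_measurable[of UNIV]) auto
    then show False
      by (simp add: emeasure_lborel_UNIV)
  qed
  then show "0 < (\<integral>x. gauss Q x \<partial>lborel)"
    by (simp add: less_le Bochner_Integration.integral_nonneg)
qed

text \<open>The numerator h satisfies h' >= t h and the mass Z satisfies Z' = t Z, so the derivative
  of h / Z is nonnegative.\<close>

lemma gauss_expectation_mono_bounded:
  fixes S T :: "real^'m^'m" and f :: "real^'m \<Rightarrow> real"
  assumes S: "pos_def S" and T: "pos_def T" and le: "S \<le> T"
    and f: "dcx_fun f" and meas [measurable]: "f \<in> borel_measurable borel"
    and b: "b < 1"
    and C: "\<And>r x. r \<in> {0..1} \<Longrightarrow> \<bar>f x\<bar> \<le> C * exp (b * (x \<bullet> (precision_path S T r *v x)) / 2)"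
  shows "(\<integral>x. f x * gauss (matrix_inv S) x \<partial>lborel) / (\<integral>x. gauss (matrix_inv S) x \<partial>lborel) \<le>
    (\<integral>x. f x * gauss (matrix_inv T) x \<partial>lborel) / (\<integral>x. gauss (matrix_inv T) x \<partial>lborel)"
proof -
  let ?Q = "precision_path S T"
  let ?D = "T - S"
  have D: "0 \<le> ?D" using le by (simp add: less_eq_vec_def)
  define h where "h = (\<lambda>r. \<integral>x. f x * gauss (?Q r) x \<partial>lborel)"
  define Z where "Z = (\<lambda>r. \<integral>x. gauss (?Q r) x \<partial>lborel)"
  define h' where "h' = (\<lambda>r. \<integral>x. f x * ((?Q r *v x) \<bullet> (?D *v (?Q r *v x)) / 2) * gauss (?Q r) x \<partial>lborel)"
  define Z' where "Z' = (\<lambda>r. \<integral>x. 1 * ((?Q r *v x) \<bullet> (?D *v (?Q r *v x)) / 2) * gauss (?Q r) x \<partial>lborel)"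
  define t where "t = (\<lambda>r. (\<Sum>i\<in>UNIV. \<Sum>j\<in>UNIV. ?D $ i $ j * ?Q r $ i $ j) / 2)"
  have Zpos: "0 < Z r" if "r \<in> {0..1}" for r
    unfolding Z_def by (intro gauss_integral_pos pos_def_precision_path S T that)
  have dh: "(h has_real_derivative h' r) (at r within {0..1})" if "r \<in> {0..1}" for r
    unfolding h_def h'_def by (rule gauss_integral_derivative[OF S T meas b C that])
  have dZ: "(Z has_real_derivative Z' r) (at r within {0..1})" if "r \<in> {0..1}" for r
    using gauss_integral_derivative[OF S T, of "\<lambda>x. 1" 0 1 r] that by (simp add: Z_def Z'_def)
  have h': "t r * h r \<le> h' r" if "r \<in> {0..1}" for r
    unfolding t_def h_def h'_def
    by (rule precision_form_dcx[OF f meas pos_def_precision_path[OF S T that] b C[OF that] D])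
  \<comment> \<open>The constants 1 and -1 are both directionally convex, which turns the inequality
    into an equality.\<close>
  have Z': "Z' r = t r * Z r" if "r \<in> {0..1}" for r
    using precision_form_dcx[OF dcx_fun_const[of 1] _ pos_def_precision_path[OF S T that], of 0 1, OF _ _ _ D]
      precision_form_dcx[OF dcx_fun_const[of "-1"] _ pos_def_precision_path[OF S T that], of 0 1, OF _ _ _ D]
    by (simp add: t_def Z_def Z'_def)
  have der: "((\<lambda>r. h r / Z r) has_real_derivative (h' r * Z r - h r * Z' r) / (Z r * Z r)) (at r within {0..1})"
    if "r \<in> {0..1}" for r
    using Zpos[OF that] by (intro DERIV_divide dh dZ that) auto
  have nonneg: "0 \<le> (h' r * Z r - h r * Z' r) / (Z r * Z r)" if "r \<in> {0..1}" for r
  proof -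
    have "(t r * h r) * Z r \<le> h' r * Z r"
      using h'[OF that] Zpos[OF that] by (intro mult_right_mono) auto
    then show ?thesis by (simp add: Z'[OF that] ac_simps)
  qed
  have "h 0 / Z 0 \<le> h 1 / Z 1"
  proof (rule DERIV_nonneg_imp_increasing_open[where f = "\<lambda>r. h r / Z r"])
    fix r :: real
    assume r: "0 < r" "r < 1"
    then have "at r within {0..1} = at r"
      by (rule at_within_Icc_at)
    then show "\<exists>y. ((\<lambda>r. h r / Z r) has_real_derivative y) (at r) \<and> 0 \<le> y"
      using der[of r] nonneg[of r] r by auto
  next
    show "continuous_on {0..1} (\<lambda>r. h r / Z r)"
      by (rule DERIV_continuous_on[OF der])
  qed simp
  then show ?thesis by (simp add: h_def Z_def)
qed


lemma precision_path_scale: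
  fixes S T :: "real^'m^'m"
  assumes "pos_def S" "pos_def T" "r \<in> {0..1}" "k > 0"
  shows "precision_path ((1 / k) *\<^sub>R S) ((1 / k) *\<^sub>R T) r = k *\<^sub>R precision_path S T r"
proof -
  let ?P = "(1 - r) *\<^sub>R S + r *\<^sub>R T"
  have "(1 - r) *\<^sub>R (1 / k) *\<^sub>R S + r *\<^sub>R (1 / k) *\<^sub>R T = (1 / k) *\<^sub>R ?P"
    by (simp add: scaleR_add_right)
  moreover have "((1 / k) *\<^sub>R ?P) ** (k *\<^sub>R matrix_inv ?P) = mat 1"
  proof -
    have "(((1 / k) *\<^sub>R ?P) ** (k *\<^sub>R matrix_inv ?P)) *v x = mat 1 *v x" for x
      using pos_def_inverse_vector(1)[OF pos_def_segment[OF assms(1-3)]] assms(4)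
      by (simp only: matrix_vector_mul_assoc[symmetric] scaleR_matrix_vector matrix_vector_mult_scaleR) simp
    then show ?thesis by (simp only: matrix_eq) simp
  qed
  ultimately show ?thesis
    unfolding precision_path_def by (simp add: matrix_inv_unique)
qed

text \<open>Only integrability at the two endpoints is assumed, so \<open>f\<close> may grow too fast for the
  intermediate Gaussians. Dividing both covariances by some \<open>k > 1\<close> makes room for the growth
  bound of \<open>dcx_fun_gauss_growth\<close>, which \<open>enclosing_box\<close> carries over from \<open>T\<close> to the
  whole segment; then \<open>k\<close> tends to \<open>1\<close>.\<close>

theorem gauss_expectation_mono:
  fixes S T :: "real^'m^'m" and f :: "real^'m \<Rightarrow> real"
  assumes S: "pos_def S" and T: "pos_def T" and le: "S \<le> T"
    and f: "dcx_fun f" and meas [measurable]: "f \<in> borel_measurable borel"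
    and intS: "integrable lborel (\<lambda>x. f x * gauss (matrix_inv S) x)"
    and intT: "integrable lborel (\<lambda>x. f x * gauss (matrix_inv T) x)"
  shows "(\<integral>x. f x * gauss (matrix_inv S) x \<partial>lborel) / (\<integral>x. gauss (matrix_inv S) x \<partial>lborel) \<le>
    (\<integral>x. f x * gauss (matrix_inv T) x \<partial>lborel) / (\<integral>x. gauss (matrix_inv T) x \<partial>lborel)"
proof -
  let ?Q = "precision_path S T"
  have scaled: "(\<integral>x. f x * gauss (k *\<^sub>R matrix_inv S) x \<partial>lborel) / (\<integral>x. gauss (k *\<^sub>R matrix_inv S) x \<partial>lborel) \<le>
    (\<integral>x. f x * gauss (k *\<^sub>R matrix_inv T) x \<partial>lborel) / (\<integral>x. gauss (k *\<^sub>R matrix_inv T) x \<partial>lborel)"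
    if k: "k > 1" for k
  proof -
    \<comment> \<open>Three strict losses cut (1, k) into thirds: k1 > 1 for the growth under T, k2
      > k1 for the passage to order intervals, k2 < k for integrability of the scaled
      Gaussians.\<close>
    define k1 where "k1 = (2 + k) / 3"
    define k2 where "k2 = (1 + 2 * k) / 3"
    have k12: "1 < k1" "k1 < k2" "k2 < k" using k by (auto simp: k1_def k2_def)
    obtain C1 where C1: "\<And>x. \<bar>f x\<bar> \<le> C1 * exp (k1 * (x \<bullet> (matrix_inv T *v x)) / 2)"
      using dcx_fun_gauss_growth[OF f meas pos_def_matrix_inv[OF T] intT k12(1)] by blast
    obtain C where C: "\<And>u x v s. u \<le> x \<Longrightarrow> x \<le> v \<Longrightarrow> u \<bullet> (matrix_inv T *v u) \<le> s \<Longrightarrow>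
        v \<bullet> (matrix_inv T *v v) \<le> s \<Longrightarrow> \<bar>f x\<bar> \<le> C * exp (k2 * s / 2)"
      using dcx_fun_box_growth[OF f pos_def_matrix_inv[OF T] _ k12(2) C1] k12(1) by auto
    have bound: "\<bar>f x\<bar> \<le> C * exp (k2 * (x \<bullet> (?Q r *v x)) / 2)" if r: "r \<in> {0..1}" for r x
    proof -
      have "(1 - r) *\<^sub>R S + r *\<^sub>R T \<le> T"
      proof -
        have "(1 - r) * S $ i $ j + r * T $ i $ j \<le> (1 - r) * T $ i $ j + r * T $ i $ j" for i j
          using le r by (intro add_right_mono mult_left_mono) (auto simp: less_eq_vec_def)
        then show ?thesis by (simp add: less_eq_vec_def algebra_simps)
      qed
      then obtain u v where "u \<le> x" "x \<le> v"
        "u \<bullet> (matrix_inv T *v u) \<le> x \<bullet> (?Q r *v x)" "v \<bullet> (matrix_inv T *v v) \<le> x \<bullet> (?Q r *v x)"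
        using enclosing_box[OF pos_def_segment[OF S T r] T] unfolding precision_path_def by metis
      then show ?thesis by (rule C)
    qed
    \<comment> \<open>Dividing the covariances by k multiplies the precisions by k and keeps the
      entrywise order, so the rate k2 becomes \<open>k2 / k\<close>.\<close>
    let ?S = "(1 / k) *\<^sub>R S" and ?T = "(1 / k) *\<^sub>R T"
    have ST: "pos_def ?S" "pos_def ?T" "?S \<le> ?T"
      using k S T le by (auto intro!: pos_def_scaleR simp: less_eq_vec_def divide_right_mono)
    have inv: "precision_path ?S ?T r = k *\<^sub>R ?Q r" if "r \<in> {0..1}" for r
      using precision_path_scale[OF S T that] k by simp
    have "\<bar>f x\<bar> \<le> C * exp ((k2 / k) * (x \<bullet> (precision_path ?S ?T r *v x)) / 2)" if "r \<in> {0..1}" for r x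
      using bound[OF that, of x] k by (simp add: inv[OF that] scaleR_matrix_vector)
    from gauss_expectation_mono_bounded[OF ST f meas _ this] show ?thesis
      using k12(3) k inv[of 0] inv[of 1] by simp
  qed
  define k where "k = (\<lambda>n. 1 + 1 / real (Suc n))"
  have k: "k n > 1" for n by (simp add: k_def)
  have k_lim: "k \<longlonglongrightarrow> 1"
    using tendsto_add[OF tendsto_const LIMSEQ_inverse_real_of_nat, of 1] by (simp add: k_def inverse_eq_divide)
  \<comment> \<open>As \<open>k n > 1\<close>, the limit integrand is itself the majorant, so
    integrability at the endpoints suffices.\<close>
  have conv: "(\<lambda>n. \<integral>x. g x * gauss (k n *\<^sub>R Q) x \<partial>lborel) \<longlonglongrightarrow> (\<integral>x. g x * gauss Q x \<partial>lborel)"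
    if int: "integrable lborel (\<lambda>x. g x * gauss Q x)" and [measurable]: "g \<in> borel_measurable borel"
      and Q: "pos_def Q" for g :: "real^'m \<Rightarrow> real" and Q
  proof (rule integral_dominated_convergence)
    show "integrable lborel (\<lambda>x. norm (g x * gauss Q x))"
      using int by (rule integrable_norm)
    show "AE x in lborel. (\<lambda>n. g x * gauss (k n *\<^sub>R Q) x) \<longlonglongrightarrow> g x * gauss Q x"
    proof (rule AE_I2)
      fix x
      have "(\<lambda>n. g x * exp (- (k n * (x \<bullet> (Q *v x))) / 2)) \<longlonglongrightarrow> g x * exp (- (1 * (x \<bullet> (Q *v x))) / 2)"
        by (intro tendsto_intros k_lim) auto
      then show "(\<lambda>n. g x * gauss (k n *\<^sub>R Q) x) \<longlonglongrightarrow> g x * gauss Q x"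
        by (simp add: gauss_def scaleR_matrix_vector)
    qed
    have "gauss (k n *\<^sub>R Q) x \<le> gauss Q x" for n x
      unfolding gauss_def
      using mult_right_mono[OF less_imp_le[OF k[of n]] pos_def_nonneg[OF Q, of x]]
      by (simp add: scaleR_matrix_vector)
    then show "AE x in lborel. norm (g x * gauss (k n *\<^sub>R Q) x) \<le> norm (g x * gauss Q x)" for n
      by (intro AE_I2) (simp add: abs_mult mult_left_mono)
  qed auto
  have ratio: "(\<lambda>n. (\<integral>x. f x * gauss (k n *\<^sub>R Q) x \<partial>lborel) / (\<integral>x. gauss (k n *\<^sub>R Q) x \<partial>lborel))
      \<longlonglongrightarrow> (\<integral>x. f x * gauss Q x \<partial>lborel) / (\<integral>x. gauss Q x \<partial>lborel)"
    if "integrable lborel (\<lambda>x. f x * gauss Q x)" "pos_def Q" for Q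
    using conv[of f Q] conv[of "\<lambda>x. 1" Q] that gauss_integral_pos[OF that(2)]
    by (intro tendsto_divide) auto
  show ?thesis
    by (rule LIMSEQ_le[OF ratio[OF intS pos_def_matrix_inv[OF S]] ratio[OF intT pos_def_matrix_inv[OF T]]])
      (use scaled[OF k] in auto)
qed

section \<open>Skew-normal densities as mixtures\<close>

lemma integral_lborel_reflect:
  fixes f :: "'a::euclidean_space \<Rightarrow> real"
  assumes [measurable]: "f \<in> borel_measurable borel"
  shows "(\<integral>x. f (- x) \<partial>lborel) = (\<integral>x. f x \<partial>lborel)"
proof -
  have "lborel = distr lborel borel (\<lambda>x::'a. - x)"
    using lborel_affine[of "-1" "0::'a"] by (simp add: density_1)
  then have "(\<integral>x. f x \<partial>lborel) = (\<integral>x. f x \<partial>distr lborel borel (\<lambda>x::'a. - x))"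
    by simp
  also have "\<dots> = (\<integral>x. f (- x) \<partial>lborel)"
    by (rule integral_distr) auto
  finally show ?thesis by simp
qed

lemma integrable_gauss_exp_norm_bound:
  fixes g :: "real^'m \<Rightarrow> real"
  assumes Q: "pos_def Q" and [measurable]: "g \<in> borel_measurable borel"
    and g: "\<And>x. \<bar>g x\<bar> \<le> C * exp (a * norm x)"
  shows "integrable lborel (\<lambda>x. g x * gauss Q x)"
proof -
  obtain c where c: "c > 0" "\<And>x. c * (norm x)\<^sup>2 \<le> x \<bullet> (Q *v x)"
    using quad_form_lower[OF Q] by blast
  have C0: "0 \<le> C" using g[of 0] by simp
  have "\<bar>g x * gauss Q x\<bar> \<le> C * exp (a * norm x - (c / 2) * (norm x)\<^sup>2)" for x
  proof -
    have "gauss Q x \<le> exp (- ((c / 2) * (norm x)\<^sup>2))"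
      unfolding gauss_def using c(2)[of x] by simp
    then have "\<bar>g x\<bar> * gauss Q x \<le> (C * exp (a * norm x)) * exp (- ((c / 2) * (norm x)\<^sup>2))"
      using C0 by (intro mult_mono g) auto
    also have "\<dots> = C * exp (a * norm x - (c / 2) * (norm x)\<^sup>2)"
      by (simp add: mult_exp_exp)
    finally show ?thesis by (simp add: abs_mult)
  qed
  then show ?thesis
    using c(1) by (intro integrable_exp_norm_bound[of "c / 2" _ C a]) auto
qed

section \<open>Moments of centred normal laws\<close>

lemma abs_component_le_exp: "\<bar>x $ i\<bar> \<le> exp (norm x)" for x :: "real^'m"
  using component_le_norm_cart[of x i] exp_ge_add_one_self[of "norm x"] by linarith

lemma abs_component_mult_le_exp: "\<bar>x $ i * x $ j\<bar> \<le> exp (2 * norm x)" for x :: "real^'m"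
  using mult_mono[OF abs_component_le_exp[of x i] abs_component_le_exp[of x j]]
  by (simp add: abs_mult mult_exp_exp)

lemma gauss_first_moment:
  fixes Q :: "real^'m^'m"
  assumes Q: "pos_def Q"
  shows "integrable lborel (\<lambda>x. x $ i * gauss Q x)" "(\<integral>x. x $ i * gauss Q x \<partial>lborel) = 0"
proof -
  show "integrable lborel (\<lambda>x. x $ i * gauss Q x)"
    by (rule integrable_gauss_exp_norm_bound[OF Q, of _ 1 1]) (auto simp: abs_component_le_exp)
  have "gauss Q (- x) = gauss Q x" for x
    using matrix_vector_mult_scaleR[of Q "-1" x] by (simp add: gauss_def)
  with integral_lborel_reflect[of "\<lambda>x. x $ i * gauss Q x"]
  show "(\<integral>x. x $ i * gauss Q x \<partial>lborel) = 0"
    by simp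
qed

text \<open>The second derivative inequality for the constants 1 and -1 shows that Q x has
  covariance Q; as x = S (Q x), that of x is S Q S = S.\<close>

lemma gauss_second_moment:
  fixes S :: "real^'m^'m"
  assumes S: "pos_def S"
  shows "integrable lborel (\<lambda>x. x $ k * x $ l * gauss (matrix_inv S) x)"
    "(\<integral>x. x $ k * x $ l * gauss (matrix_inv S) x \<partial>lborel) = S $ k $ l * (\<integral>x. gauss (matrix_inv S) x \<partial>lborel)"
proof -
  let ?Q = "matrix_inv S" and ?Z = "\<integral>x. gauss (matrix_inv S) x \<partial>lborel"
  note Q = pos_def_matrix_inv[OF S]
  show "integrable lborel (\<lambda>x. x $ k * x $ l * gauss ?Q x)"
    by (rule integrable_gauss_exp_norm_bound[OF Q, of _ 1 2]) (auto simp: abs_component_mult_le_exp)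
  have int: "integrable lborel (\<lambda>x. (?Q *v x) $ i * (?Q *v x) $ j * gauss ?Q x)" for i j
    using dcx_fun_gauss_second_derivative(2)[OF dcx_fun_const[of 1] _ Q, of 0 1 i j] by simp
  have m: "(\<integral>x. (?Q *v x) $ i * (?Q *v x) $ j * gauss ?Q x \<partial>lborel) = ?Q $ i $ j * ?Z" for i j
    using dcx_fun_gauss_second_derivative(3)[OF dcx_fun_const[of 1] _ Q, of 0 1 i j]
      dcx_fun_gauss_second_derivative(3)[OF dcx_fun_const[of "-1"] _ Q, of 0 1 i j]
    by simp
  have comp: "x $ k = (\<Sum>i\<in>UNIV. S $ k $ i * (?Q *v x) $ i)" for x k
    using pos_def_inverse_vector(1)[OF S, of x] by (metis (no_types, lifting) matrix_vector_mult_def sum.cong vec_lambda_beta)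
  have prod: "x $ k * x $ l * gauss ?Q x = (\<Sum>i\<in>UNIV. \<Sum>j\<in>UNIV. (S $ k $ i * S $ l $ j) * ((?Q *v x) $ i * (?Q *v x) $ j * gauss ?Q x))" for x
  proof -
    have "x $ k * x $ l * gauss ?Q x =
        (\<Sum>i\<in>UNIV. S $ k $ i * (?Q *v x) $ i) * (\<Sum>j\<in>UNIV. S $ l $ j * (?Q *v x) $ j) * gauss ?Q x"
      using comp[of x k] comp[of x l] by simp
    also have "\<dots> = (\<Sum>i\<in>UNIV. \<Sum>j\<in>UNIV. S $ k $ i * (?Q *v x) $ i * (S $ l $ j * (?Q *v x) $ j) * gauss ?Q x)"
      by (subst sum_product) (simp add: sum_distrib_right)
    finally show ?thesis by (simp only: ac_simps)
  qed
  have "(\<integral>x. x $ k * x $ l * gauss ?Q x \<partial>lborel) = (\<Sum>i\<in>UNIV. \<Sum>j\<in>UNIV. (S $ k $ i * S $ l $ j) * (?Q $ i $ j * ?Z))"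
    unfolding prod by (simp only: Bochner_Integration.integral_sum Bochner_Integration.integrable_sum
      integrable_mult_right integral_mult_right_zero int m)
  also have "\<dots> = (\<Sum>i\<in>UNIV. S $ k $ i * (\<Sum>j\<in>UNIV. ?Q $ i $ j * S $ j $ l)) * ?Z"
    by (simp add: sum_distrib_left sum_distrib_right pos_def_entry_sym[OF S, of l] ac_simps)
  also have "\<dots> = (\<Sum>i\<in>UNIV. S $ k $ i * (if i = l then 1 else 0)) * ?Z"
    using pos_def_inverse(2)[OF S]
    by (simp add: matrix_matrix_mult_def mat_def vec_eq_iff)
  finally show "(\<integral>x. x $ k * x $ l * gauss ?Q x \<partial>lborel) = S $ k $ l * ?Z"
    by (simp add: if_distrib cong: if_cong)
qed

text \<open>Unnormalised density of |U| for a standard normal U.\<close>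

definition half_normal_weight :: "real \<Rightarrow> real" where
  "half_normal_weight u = indicator {0..} u * exp (- u\<^sup>2 / 2)"

lemma half_normal_weight_nonneg [simp]: "0 \<le> half_normal_weight u"
  by (simp add: half_normal_weight_def)

lemma borel_measurable_half_normal_weight [measurable]: "half_normal_weight \<in> borel_measurable borel"
  unfolding half_normal_weight_def[abs_def] by measurable

text \<open>Substituting \<open>sqrt 2 * x\<close> leads to half-line integrals of exp(-x^2).
  Divided by the mass, the moments of |U| are \<open>1 / sqrt (pi / 2)\<close> and 1.\<close>

lemma half_normal_moments:
  shows "has_bochner_integral lborel half_normal_weight (sqrt (pi / 2))"
    and "has_bochner_integral lborel (\<lambda>u. half_normal_weight u * u) 1"
    and "has_bochner_integral lborel (\<lambda>u. half_normal_weight u * u\<^sup>2) (sqrt (pi / 2))"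
proof -
  have ind: "indicator {0..} (sqrt 2 * x) = (indicator {0..} x :: real)" for x :: real
    by (auto simp: indicator_def zero_le_mult_iff)
  note ind = ind ind[unfolded mult.commute[of "sqrt 2"]]
  have rescale: "has_bochner_integral lborel f (sqrt 2 * v)"
    if "has_bochner_integral lborel (\<lambda>x. f (0 + sqrt 2 * x)) v" for f and v :: real
    by (subst lborel_has_bochner_integral_real_affine_iff[where c = "sqrt 2" and t = 0])
      (use that in \<open>auto simp flip: mult.assoc\<close>)
  have s: "sqrt 2 * sqrt pi / 2 = sqrt (pi / 2)"
    by (simp add: real_sqrt_divide field_simps)
  have 0: "has_bochner_integral lborel (\<lambda>x. half_normal_weight (0 + sqrt 2 * x)) (sqrt pi / 2)"
    using gaussian_moment_even_pos[of 0] by (simp add: half_normal_weight_def ind power_mult_distrib)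
  show "has_bochner_integral lborel half_normal_weight (sqrt (pi / 2))"
    using rescale[OF 0] by (simp add: s)
  have 1: "has_bochner_integral lborel (\<lambda>x. half_normal_weight (0 + sqrt 2 * x) * (0 + sqrt 2 * x)) (sqrt 2 / 2)"
    using has_bochner_integral_mult_right[OF gaussian_moment_odd_pos[of 0], of "sqrt 2"]
    by (simp add: half_normal_weight_def ind power_mult_distrib ac_simps)
  show "has_bochner_integral lborel (\<lambda>u. half_normal_weight u * u) 1"
    using rescale[OF 1] by simp
  have 2: "has_bochner_integral lborel (\<lambda>x. half_normal_weight (0 + sqrt 2 * x) * (0 + sqrt 2 * x)\<^sup>2) (sqrt pi / 2)"
    using has_bochner_integral_mult_right[OF gaussian_moment_even_pos[of 1], of 2]
    by (simp add: half_normal_weight_def ind power_mult_distrib ac_simps fact_numeral power2_eq_square)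
  show "has_bochner_integral lborel (\<lambda>u. half_normal_weight u * u\<^sup>2) (sqrt (pi / 2))"
    using rescale[OF 2] by (simp add: s)
qed

text \<open>The origin of \<Phi> in the skew-normal density: v = (t - u) / \<sigma> reverses
  orientation and carries \<open>{0..}\<close> onto \<open>{..t / \<sigma>}\<close>.\<close>

lemma half_line_normal_integral:
  fixes t \<sigma> :: real
  assumes \<sigma>: "\<sigma> > 0"
  shows "has_bochner_integral lborel (\<lambda>u. indicator {0..} u * exp (- (u - t)\<^sup>2 / (2 * \<sigma>\<^sup>2)))
    (sqrt (2 * pi) * \<sigma> * cdf std_normal_distribution (t / \<sigma>))"
proof -
  have "has_bochner_integral lborel (\<lambda>v. std_normal_density v * indicator {..t / \<sigma>} v) (cdf std_normal_distribution (t / \<sigma>))"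
  proof -
    interpret real_distribution std_normal_distribution
      by (rule real_dist_normal_dist)
    have "integrable std_normal_distribution (indicator {..t / \<sigma>} :: real \<Rightarrow> real)"
      by (intro integrable_real_indicator) (auto simp: emeasure_eq_measure)
    moreover have "(\<integral>v. indicator {..t / \<sigma>} v \<partial>std_normal_distribution) = cdf std_normal_distribution (t / \<sigma>)"
      by (simp add: cdf_def)
    moreover have "(\<integral>v. indicator {..t / \<sigma>} v \<partial>std_normal_distribution) =
        (\<integral>v. std_normal_density v * indicator {..t / \<sigma>} v \<partial>lborel)"
      by (rule integral_real_density) auto
    ultimately show ?thesis
      by (simp add: has_bochner_integral_iff integrable_density)
  qed
  from has_bochner_integral_mult_right[OF this, of "sqrt (2 * pi)"]
  have "has_bochner_integral lborel (\<lambda>v. exp (- v\<^sup>2 / 2) * indicator {..t / \<sigma>} v) (sqrt (2 * pi) * cdf std_normal_distribution (t / \<sigma>))"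
    by (simp add: normal_density_def)
  also have "(\<lambda>v. exp (- v\<^sup>2 / 2) * indicator {..t / \<sigma>} v) =
      (\<lambda>v. indicator {0..} (t + (- \<sigma>) * v) * exp (- ((t + (- \<sigma>) * v) - t)\<^sup>2 / (2 * \<sigma>\<^sup>2)) :: real)"
    using \<sigma> by (auto simp: fun_eq_iff indicator_def field_simps power_mult_distrib)
  finally show ?thesis
    using \<sigma> by (subst lborel_has_bochner_integral_real_affine_iff[where c = "- \<sigma>" and t = t])
      (auto simp: mult.commute[of _ \<sigma>] mult.assoc simp flip: mult.assoc[of "inverse \<sigma>"])
qed

section \<open>Rank-one downdates and the conditional covariance\<close>

definition outer_square :: "real^'m \<Rightarrow> real^'m^'m" where
  "outer_square d = (\<chi> i j. d $ i * d $ j)"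

lemma outer_square_vector: "outer_square d *v x = (d \<bullet> x) *\<^sub>R d"
  by (simp add: outer_square_def matrix_vector_mult_def vec_eq_iff inner_vec_def sum_distrib_left ac_simps)

text \<open>The dual Cauchy-Schwarz inequality turns admissibility of d into (d^T x)^2 < x^T R x for
  nonzero x.\<close>

lemma pos_def_downdate:
  fixes R :: "real^'m^'m"
  assumes R: "pos_def R" and d: "d \<bullet> (matrix_inv R *v d) < 1"
  shows "pos_def (R - outer_square d)"
proof (rule pos_defI)
  show "((R - outer_square d) *v x) \<bullet> y = x \<bullet> ((R - outer_square d) *v y)" for x y
    using pos_def_inner[OF R, of x y]
    by (simp add: matrix_vector_mult_diff_rdistrib outer_square_vector inner_diff_left inner_diff_right
        inner_commute[of d])
  fix x :: "real^'m"
  assume "x \<noteq> 0"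
  then have x: "0 < x \<bullet> (R *v x)" by (rule pos_def_pos[OF R])
  have "(d \<bullet> x)\<^sup>2 \<le> (d \<bullet> (matrix_inv R *v d)) * (x \<bullet> (R *v x))"
    by (rule pos_def_cauchy_dual[OF R])
  also have "\<dots> < 1 * (x \<bullet> (R *v x))"
    using d x by (intro mult_strict_right_mono)
  finally show "0 < x \<bullet> ((R - outer_square d) *v x)"
    by (simp add: matrix_vector_mult_diff_rdistrib outer_square_vector inner_diff_right power2_eq_square inner_commute)
qed

text \<open>The Sherman-Morrison formula, verified by multiplying out.\<close>

lemma matrix_inv_downdate:
  fixes R :: "real^'m^'m"
  assumes R: "pos_def R" and d: "d \<bullet> (matrix_inv R *v d) < 1"
  defines "q \<equiv> matrix_inv R *v d"
  shows "matrix_inv (R - outer_square d) *v x = matrix_inv R *v x + ((q \<bullet> x) / (1 - d \<bullet> q)) *\<^sub>R q"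
proof -
  let ?S = "R - outer_square d"
  let ?y = "matrix_inv R *v x + ((q \<bullet> x) / (1 - d \<bullet> q)) *\<^sub>R q"
  have qx: "d \<bullet> (matrix_inv R *v x) = q \<bullet> x"
    unfolding q_def by (simp add: pos_def_inner[OF pos_def_matrix_inv[OF R]])
  have Rq: "R *v q = d"
    by (simp add: q_def pos_def_inverse_vector[OF R])
  have s: "1 - d \<bullet> q \<noteq> 0"
    using d by (simp add: q_def)
  have coef: "(q \<bullet> x) / (1 - d \<bullet> q) - (q \<bullet> x + (q \<bullet> x) / (1 - d \<bullet> q) * (d \<bullet> q)) = 0"
    using s by (simp add: field_simps)
  have "?S *v ?y = x + ((q \<bullet> x) / (1 - d \<bullet> q) - (q \<bullet> x + (q \<bullet> x) / (1 - d \<bullet> q) * (d \<bullet> q))) *\<^sub>R d"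
    by (simp add: matrix_vector_mult_diff_rdistrib outer_square_vector matrix_vector_right_distrib
        matrix_vector_mult_scaleR pos_def_inverse_vector[OF R] Rq inner_add_right qx
        scaleR_diff_left scaleR_diff_right scaleR_add_left)
  then have "?S *v ?y = x"
    unfolding coef by simp
  then show ?thesis
    using pos_def_inverse_vector(2)[OF pos_def_downdate[OF R d], of ?y] by simp
qed

text \<open>Completing the square in the variable \<open>u\<close> of the representation \<open>Z = u d + W\<close>.\<close>

lemma gauss_downdate:
  fixes R :: "real^'m^'m"
  assumes R: "pos_def R" and d: "d \<bullet> (matrix_inv R *v d) < 1"
  defines "q \<equiv> matrix_inv R *v d"
  shows "exp (- u\<^sup>2 / 2) * gauss (matrix_inv (R - outer_square d)) (z - u *\<^sub>R d) =
    gauss (matrix_inv R) z * exp (- (u - q \<bullet> z)\<^sup>2 / (2 * (1 - d \<bullet> q)))"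
proof -
  let ?P = "matrix_inv (R - outer_square d)"
  note S = pos_def_downdate[OF R d]
  have Pv: "?P *v x = matrix_inv R *v x + ((q \<bullet> x) / (1 - d \<bullet> q)) *\<^sub>R q" for x
    unfolding q_def by (rule matrix_inv_downdate[OF R d])
  have s: "1 - d \<bullet> q \<noteq> 0"
    using d by (simp add: q_def)
  have Rd: "matrix_inv R *v d = q" by (simp add: q_def)
  \<comment> \<open>The conditional variance of u given z, before restriction to the half-line; the
    conditional mean is \<open>q \<bullet> z\<close>.\<close>
  define s where "s = 1 - d \<bullet> q"
  have s0: "s \<noteq> 0" using s by (simp add: s_def)
  have dq: "d \<bullet> q = 1 - s" by (simp add: s_def)
  have Pd: "?P *v d = (1 / s) *\<^sub>R q"
  proof -
    have "?P *v d = (1 + (1 - s) / s) *\<^sub>R q"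
      unfolding Pv Rd inner_commute[of q d] dq by (simp add: scaleR_add_left s_def[symmetric] dq)
    then show ?thesis using s0 by (simp add: field_simps)
  qed
  have "(z - u *\<^sub>R d) \<bullet> (?P *v (z - u *\<^sub>R d)) =
      z \<bullet> (?P *v z) - 2 * (z \<bullet> (?P *v (u *\<^sub>R d))) + (u *\<^sub>R d) \<bullet> (?P *v (u *\<^sub>R d))"
    by (rule quad_form_diff[OF pos_def_matrix_inv[OF S]])
  also have "\<dots> = z \<bullet> (matrix_inv R *v z) + (q \<bullet> z)\<^sup>2 / s - 2 * u * (q \<bullet> z) / s + u\<^sup>2 * (1 - s) / s"
    unfolding matrix_vector_mult_scaleR Pd
    by (simp add: Pv dq s_def[symmetric] inner_add_right inner_commute[of z q] power2_eq_square)
  finally have eq: "(z - u *\<^sub>R d) \<bullet> (?P *v (z - u *\<^sub>R d)) =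
      z \<bullet> (matrix_inv R *v z) + (q \<bullet> z)\<^sup>2 / s - 2 * u * (q \<bullet> z) / s + u\<^sup>2 * (1 - s) / s" .
  have "u\<^sup>2 + (a + b\<^sup>2 / s - 2 * u * b / s + u\<^sup>2 * (1 - s) / s) = a + (u - b)\<^sup>2 / s" for a b
    using s0 by (simp add: field_simps power2_eq_square)
  then have "u\<^sup>2 + (z - u *\<^sub>R d) \<bullet> (?P *v (z - u *\<^sub>R d)) = z \<bullet> (matrix_inv R *v z) + (u - q \<bullet> z)\<^sup>2 / s"
    unfolding eq .
  then have "- u\<^sup>2 / 2 + - ((z - u *\<^sub>R d) \<bullet> (?P *v (z - u *\<^sub>R d))) / 2 =
      - (z \<bullet> (matrix_inv R *v z)) / 2 + - (u - q \<bullet> z)\<^sup>2 / (2 * s)"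
    by (simp add: field_simps)
  then show ?thesis
    unfolding gauss_def by (simp only: s_def mult_exp_exp)
qed

lemma matrix_inv_mat_1 [simp]: "matrix_inv (mat 1) = (mat 1 :: real^'m^'m)"
  by (rule matrix_inv_unique) simp

lemma scale_diag_unit: "(\<And>i. R $ i $ i = 1) \<Longrightarrow> scale_diag R = mat 1"
  by (simp add: scale_diag_def mat_def vec_eq_iff)

text \<open>With unit diagonal the skewness parameter is q / \<sigma>, where q = R^{-1} d.
  Integrating the completed square over u >= 0 produces \<Phi> at exactly q^T z / \<sigma>. The
  constant stays abstract, since the total mass 1 fixes it later.\<close>

lemma sn_density_mixture:
  fixes R :: "real^'m^'m"
  assumes R: "pos_def R" and diag: "\<And>i. R $ i $ i = 1" and d: "d \<bullet> (matrix_inv R *v d) < 1"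
  obtains K where "0 \<le> K"
    "\<And>z. integrable lborel (\<lambda>u. half_normal_weight u * gauss (matrix_inv (R - outer_square d)) (z - u *\<^sub>R d))"
    "\<And>z. sn_density 0 R (sn_alpha R d) z =
      K * (\<integral>u. half_normal_weight u * gauss (matrix_inv (R - outer_square d)) (z - u *\<^sub>R d) \<partial>lborel)"
proof -
  define q where "q = matrix_inv R *v d"
  define \<sigma> where "\<sigma> = sqrt (1 - d \<bullet> q)"
  have \<sigma>: "\<sigma> > 0" "\<sigma>\<^sup>2 = 1 - d \<bullet> q"
    using d by (auto simp: \<sigma>_def q_def)
  define c where "c = (2 * pi) powr (- real CARD('m) / 2) * det R powr (- 1 / 2)"
  have dens: "sn_density 0 R (sn_alpha R d) z = 2 * c * gauss (matrix_inv R) z * cdf std_normal_distribution (q \<bullet> z / \<sigma>)" for z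
  proof -
    have "(1 - d \<bullet> q) powr (- 1 / 2) = 1 / \<sigma>"
      using d by (simp add: \<sigma>_def q_def powr_minus_divide powr_half_sqrt)
    then show ?thesis
      unfolding sn_density_def mvn_density_def sn_alpha_def scale_diag_unit[OF diag]
      by (simp add: q_def[symmetric] c_def gauss_def)
  qed
  let ?F = "\<lambda>z u. half_normal_weight u * gauss (matrix_inv (R - outer_square d)) (z - u *\<^sub>R d)"
  have F: "has_bochner_integral lborel (?F z)
      (gauss (matrix_inv R) z * (sqrt (2 * pi) * \<sigma> * cdf std_normal_distribution (q \<bullet> z / \<sigma>)))" for z
  proof -
    have "?F z = (\<lambda>u. gauss (matrix_inv R) z * (indicator {0..} u * exp (- (u - q \<bullet> z)\<^sup>2 / (2 * \<sigma>\<^sup>2))))"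
      unfolding half_normal_weight_def mult.assoc gauss_downdate[OF R d] q_def[symmetric] \<sigma>(2)
      by (simp add: fun_eq_iff)
    then show ?thesis
      using has_bochner_integral_mult_right[OF half_line_normal_integral[OF \<sigma>(1)]] by simp
  qed
  show thesis
  proof
    show "0 \<le> 2 * c / (sqrt (2 * pi) * \<sigma>)"
      using \<sigma>(1) by (simp add: c_def)
    show "integrable lborel (?F z)" for z
      using F[of z] by (simp add: has_bochner_integral_iff)
    show "sn_density 0 R (sn_alpha R d) z = 2 * c / (sqrt (2 * pi) * \<sigma>) * (\<integral>u. ?F z u \<partial>lborel)" for z
      using has_bochner_integral_integral_eq[OF F[of z]] \<sigma>(1) dens[of z] by simp
  qed
qed

section \<open>Integrals against skew-normal densities\<close>

lemma sn_density_bounds: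
  fixes R :: "real^'m^'m"
  shows "0 \<le> sn_density \<mu> R \<alpha> z" "sn_density \<mu> R \<alpha> z \<le> 2 * mvn_density \<mu> R z"
proof -
  interpret real_distribution std_normal_distribution
    by (rule real_dist_normal_dist)
  have nonneg: "0 \<le> 2 * mvn_density \<mu> R z" by (simp add: mvn_density_def)
  show "0 \<le> sn_density \<mu> R \<alpha> z"
    unfolding sn_density_def by (rule mult_nonneg_nonneg[OF nonneg cdf_nonneg])
  show "sn_density \<mu> R \<alpha> z \<le> 2 * mvn_density \<mu> R z"
    unfolding sn_density_def by (rule mult_left_le[OF cdf_bounded_prob nonneg])
qed

text \<open>The mean of \<open>g (v + W)\<close> for a centred normal W with covariance S.\<close>

definition gauss_mean :: "real^'m^'m \<Rightarrow> real^'m \<Rightarrow> (real^'m \<Rightarrow> real) \<Rightarrow> real" where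
  "gauss_mean S v g = (\<integral>w. g (v + w) * gauss (matrix_inv S) w \<partial>lborel) / (\<integral>w. gauss (matrix_inv S) w \<partial>lborel)"

text \<open>Fubini in (z, u) followed by the shift z = u d + w. The last claim supplies the
  integrability under which conditional means can be compared; it concerns positive weights because
  the joint integrand vanishes for u < 0.\<close>

lemma sn_mixture_integral:
  fixes R :: "real^'m^'m" and d :: "real^'m" and g :: "real^'m \<Rightarrow> real"
  defines "p \<equiv> sn_density 0 R (sn_alpha R d)" and "S \<equiv> R - outer_square d"
  assumes R: "pos_def R" and diag: "\<And>i. R $ i $ i = 1" and d: "d \<bullet> (matrix_inv R *v d) < 1"
    and p: "integrable lborel p" "(\<integral>z. p z \<partial>lborel) = 1"
    and [measurable]: "g \<in> borel_measurable borel" and g: "integrable lborel (\<lambda>z. p z * g z)"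
  shows "integrable lborel (\<lambda>u. half_normal_weight u * gauss_mean S (u *\<^sub>R d) g)"
    "(\<integral>z. p z * g z \<partial>lborel) =
      (\<integral>u. half_normal_weight u * gauss_mean S (u *\<^sub>R d) g \<partial>lborel) / sqrt (pi / 2)"
    "AE u in lborel. half_normal_weight u \<noteq> 0 \<longrightarrow>
      integrable lborel (\<lambda>w. g (u *\<^sub>R d + w) * gauss (matrix_inv S) w)"
proof -
  let ?P = "matrix_inv S"
  have S: "pos_def S" unfolding S_def by (rule pos_def_downdate[OF R d])
  define Z where "Z = (\<integral>w. gauss ?P w \<partial>lborel)"
  have Z: "Z > 0" unfolding Z_def by (intro gauss_integral_pos pos_def_matrix_inv S)
  define k where "k = (\<lambda>z u. half_normal_weight u * gauss ?P (z - u *\<^sub>R d))"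
  obtain K where K: "0 \<le> K" and k_int: "\<And>z. integrable lborel (k z)"
    and p_eq: "\<And>z. p z = K * (\<integral>u. k z u \<partial>lborel)"
    using sn_density_mixture[OF R diag d] unfolding k_def p_def S_def by blast
  have K_neq: "K \<noteq> 0" using p(2) unfolding p_eq by auto
  have k_nonneg: "0 \<le> k z u" for z u by (simp add: k_def)
  have k_meas [measurable]: "(\<lambda>x. k (fst x) (snd x)) \<in> borel_measurable (lborel \<Otimes>\<^sub>M lborel)"
    unfolding k_def by measurable
  text \<open>Fubini for a general integrand; \<open>h = 1\<close> yields the normalising constant \<open>K\<close>.\<close>
  have fubini: "integrable lborel (\<lambda>u. half_normal_weight u * gauss_mean S (u *\<^sub>R d) h)"
      "(\<integral>z. p z * h z \<partial>lborel) = K * Z * (\<integral>u. half_normal_weight u * gauss_mean S (u *\<^sub>R d) h \<partial>lborel)"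
      "AE u in lborel. half_normal_weight u \<noteq> 0 \<longrightarrow>
        integrable lborel (\<lambda>w. h (u *\<^sub>R d + w) * gauss ?P w)"
    if [measurable]: "h \<in> borel_measurable borel" and h: "integrable lborel (\<lambda>z. p z * h z)" for h
  proof -
    have int: "integrable (lborel \<Otimes>\<^sub>M lborel) (\<lambda>x. h (fst x) * k (fst x) (snd x))"
    proof (rule lborel_pair.Fubini_integrable)
      \<comment> \<open>The kernel is nonnegative, so integrating the absolute value over u first
        returns the density: integrability against p is just what Fubini requires.\<close>
      have "(\<integral>u. norm (h z * k z u) \<partial>lborel) = norm (p z * h z) / K" for z
      proof -
        have "(\<integral>u. norm (h z * k z u) \<partial>lborel) = norm (h z) * (\<integral>u. k z u \<partial>lborel)"
          using k_nonneg[of z] by (simp add: abs_mult)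
        moreover have "0 \<le> (\<integral>u. k z u \<partial>lborel)"
          by (intro Bochner_Integration.integral_nonneg k_nonneg)
        ultimately show ?thesis
          using K K_neq by (simp add: p_eq abs_mult)
      qed
      then show "integrable lborel (\<lambda>z. \<integral>u. norm (h (fst (z, u)) * k (fst (z, u)) (snd (z, u))) \<partial>lborel)"
        using integrable_norm[OF h] by simp
      show "AE z in lborel. integrable lborel (\<lambda>u. h (fst (z, u)) * k (fst (z, u)) (snd (z, u)))"
        using k_int by simp
    qed measurable
    then have int': "integrable (lborel \<Otimes>\<^sub>M lborel) (case_prod (\<lambda>z u. h z * k z u))"
      by (simp add: case_prod_beta')
    have shift: "(\<integral>z. h z * k z u \<partial>lborel) = Z * (half_normal_weight u * gauss_mean S (u *\<^sub>R d) h)"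
      if i: "integrable lborel (\<lambda>z. h z * k z u)" for u
    proof -
      have "(\<integral>z. h z * k z u \<partial>lborel) = (\<integral>w. h (u *\<^sub>R d + w) * k (u *\<^sub>R d + w) u \<partial>lborel)"
        by (rule integrable_lborel_translate(2)[OF i, symmetric])
      also have "\<dots> = half_normal_weight u * (\<integral>w. h (u *\<^sub>R d + w) * gauss ?P w \<partial>lborel)"
        unfolding k_def by (simp add: mult.left_commute[of "h _"])
      finally show ?thesis
        using Z by (simp add: gauss_mean_def Z_def[symmetric])
    qed
    have AE: "AE u in lborel. integrable lborel (\<lambda>z. h z * k z u)"
      by (rule lborel_pair.AE_integrable_snd[OF int'])
    show "AE u in lborel. half_normal_weight u \<noteq> 0 \<longrightarrow>
        integrable lborel (\<lambda>w. h (u *\<^sub>R d + w) * gauss ?P w)"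
      using AE
    proof eventually_elim
      case (elim u)
      show ?case
      proof
        assume u: "half_normal_weight u \<noteq> 0"
        have "integrable lborel (\<lambda>w. (1 / half_normal_weight u) * (h (u *\<^sub>R d + w) * k (u *\<^sub>R d + w) u))"
          by (intro integrable_mult_right integrable_lborel_translate(1)[OF elim])
        then show "integrable lborel (\<lambda>w. h (u *\<^sub>R d + w) * gauss ?P w)"
          using u by (simp add: k_def)
      qed
    qed
    have [measurable]: "(\<lambda>u. gauss_mean S (u *\<^sub>R d) h) \<in> borel_measurable borel"
      unfolding gauss_mean_def by measurable
    have [measurable]: "(\<lambda>u. \<integral>z. h z * k z u \<partial>lborel) \<in> borel_measurable borel"
      using borel_measurable_integrable[OF lborel_pair.integrable_snd[OF int']] by simp
    have AE_eq: "AE u in lborel. (\<integral>z. h z * k z u \<partial>lborel) = Z * (half_normal_weight u * gauss_mean S (u *\<^sub>R d) h)"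
      using AE by eventually_elim (rule shift)
    have "integrable lborel (\<lambda>u. Z * (half_normal_weight u * gauss_mean S (u *\<^sub>R d) h))"
      using lborel_pair.integrable_snd[OF int'] AE_eq
      by (subst integrable_cong_AE[symmetric, where f = "\<lambda>u. \<integral>z. h z * k z u \<partial>lborel"]) auto
    then show "integrable lborel (\<lambda>u. half_normal_weight u * gauss_mean S (u *\<^sub>R d) h)"
      using Z by (simp add: integrable_mult_left_iff)
    have "(\<integral>z. p z * h z \<partial>lborel) = K * (\<integral>z. (\<integral>u. h z * k z u \<partial>lborel) \<partial>lborel)"
      by (simp add: p_eq ac_simps)
    also have "(\<integral>z. (\<integral>u. h z * k z u \<partial>lborel) \<partial>lborel) = (\<integral>u. (\<integral>z. h z * k z u \<partial>lborel) \<partial>lborel)"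
      using lborel_pair.integral_fst[OF int'] lborel_pair.integral_snd[OF int'] by simp
    also have "\<dots> = (\<integral>u. Z * (half_normal_weight u * gauss_mean S (u *\<^sub>R d) h) \<partial>lborel)"
      using AE_eq by (intro integral_cong_AE) auto
    finally show "(\<integral>z. p z * h z \<partial>lborel) = K * Z * (\<integral>u. half_normal_weight u * gauss_mean S (u *\<^sub>R d) h \<partial>lborel)"
      by simp
  qed
  have "gauss_mean S v (\<lambda>z. 1) = 1" for v
    using Z by (simp add: gauss_mean_def Z_def)
  then have "1 = K * Z * sqrt (pi / 2)"
    using fubini(2)[of "\<lambda>z. 1"] p half_normal_moments(1) by (simp add: has_bochner_integral_iff)
  then have KZ: "K * Z = 1 / sqrt (pi / 2)"
    by (simp add: field_simps)
  show "integrable lborel (\<lambda>u. half_normal_weight u * gauss_mean S (u *\<^sub>R d) g)"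
    "AE u in lborel. half_normal_weight u \<noteq> 0 \<longrightarrow>
      integrable lborel (\<lambda>w. g (u *\<^sub>R d + w) * gauss ?P w)"
    by (rule fubini[OF _ g], measurable)+
  show "(\<integral>z. p z * g z \<partial>lborel) =
      (\<integral>u. half_normal_weight u * gauss_mean S (u *\<^sub>R d) g \<partial>lborel) / sqrt (pi / 2)"
    using fubini(2)[OF _ g] KZ by simp
qed

lemma sn_integrable_exp_bound:
  fixes R :: "real^'m^'m" and g :: "real^'m \<Rightarrow> real"
  assumes R: "pos_def R" and p: "integrable lborel (sn_density 0 R a)" and [measurable]: "g \<in> borel_measurable borel"
    and g: "\<And>x. \<bar>g x\<bar> \<le> C * exp (b * norm x)"
  shows "integrable lborel (\<lambda>z. sn_density 0 R a z * g z)"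
proof (rule Bochner_Integration.integrable_bound)
  define c where "c = (2 * pi) powr (- real CARD('m) / 2) * det R powr (- 1 / 2)"
  have m: "mvn_density 0 R z = c * gauss (matrix_inv R) z" for z
    by (simp add: mvn_density_def c_def gauss_def)
  have c: "0 \<le> c" by (simp add: c_def)
  show "integrable lborel (\<lambda>z. (2 * c) * (g z * gauss (matrix_inv R) z))"
    by (intro integrable_mult_right integrable_gauss_exp_norm_bound[OF pos_def_matrix_inv[OF R] _ g]) measurable
  have [measurable]: "sn_density 0 R a \<in> borel_measurable borel"
    using p by auto
  show "(\<lambda>z. sn_density 0 R a z * g z) \<in> borel_measurable lborel"
    by measurable
  show "AE z in lborel. norm (sn_density 0 R a z * g z) \<le> norm ((2 * c) * (g z * gauss (matrix_inv R) z))"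
  proof (rule AE_I2)
    fix z
    have "sn_density 0 R a z * \<bar>g z\<bar> \<le> (2 * (c * gauss (matrix_inv R) z)) * \<bar>g z\<bar>"
      using sn_density_bounds(2)[of 0 R a z] by (intro mult_right_mono) (auto simp: m)
    then show "norm (sn_density 0 R a z * g z) \<le> norm ((2 * c) * (g z * gauss (matrix_inv R) z))"
      using c sn_density_bounds(1)[of 0 R a z] by (simp add: abs_mult ac_simps)
  qed
qed

text \<open>Given |U| = u the mean is u d and the covariance R - d d^T. Since E |U|^2 = 1, averaging
  restores the matrix removed by the downdate, and the second moments are the entries of R.\<close>

lemma sn_moments:
  fixes R :: "real^'m^'m" and d :: "real^'m"
  defines "p \<equiv> sn_density 0 R (sn_alpha R d)"
  assumes R: "pos_def R" and diag: "\<And>i. R $ i $ i = 1" and d: "d \<bullet> (matrix_inv R *v d) < 1"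
    and p: "integrable lborel p" "(\<integral>z. p z \<partial>lborel) = 1"
  shows "integrable lborel (\<lambda>z. p z * z $ i)" "(\<integral>z. p z * z $ i \<partial>lborel) = d $ i / sqrt (pi / 2)"
    "integrable lborel (\<lambda>z. p z * (z $ i * z $ j))" "(\<integral>z. p z * (z $ i * z $ j) \<partial>lborel) = R $ i $ j"
proof -
  let ?S = "R - outer_square d"
  note S = pos_def_downdate[OF R d]
  note mom1 = gauss_first_moment[OF pos_def_matrix_inv[OF S]]
  note mom2 = gauss_second_moment[OF S]
  note Z = gauss_integral_pos[OF pos_def_matrix_inv[OF S]]
  note hn = half_normal_moments[unfolded has_bochner_integral_iff]
  show int1: "integrable lborel (\<lambda>z. p z * z $ i)"
    unfolding p_def by (rule sn_integrable_exp_bound[OF R p(1)[unfolded p_def], of _ 1 1]) (auto simp: abs_component_le_exp)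
  show int2: "integrable lborel (\<lambda>z. p z * (z $ i * z $ j))"
    unfolding p_def by (rule sn_integrable_exp_bound[OF R p(1)[unfolded p_def], of _ 1 2]) (auto simp: abs_component_mult_le_exp)
  have "gauss_mean ?S v (\<lambda>z. z $ i) = v $ i" for v
    using Z by (simp add: gauss_mean_def distrib_right mom1)
  then show "(\<integral>z. p z * z $ i \<partial>lborel) = d $ i / sqrt (pi / 2)"
    using sn_mixture_integral(2)[OF R diag d p[unfolded p_def] _ int1[unfolded p_def]] hn
    by (simp add: p_def mult.assoc[symmetric])
  have "gauss_mean ?S v (\<lambda>z. z $ i * z $ j) = v $ i * v $ j + ?S $ i $ j" for v
  proof -
    let ?g = "gauss (matrix_inv ?S)"
    have "(v + w) $ i * (v + w) $ j * ?g w =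
        v $ i * v $ j * ?g w + v $ i * (w $ j * ?g w) + v $ j * (w $ i * ?g w) + w $ i * w $ j * ?g w" for w
      by (simp add: algebra_simps)
    then show ?thesis
      using Z by (simp add: gauss_mean_def mom1 mom2 add_divide_distrib)
  qed
  then have "(\<integral>z. p z * (z $ i * z $ j) \<partial>lborel) =
      (\<integral>u. half_normal_weight u * (u\<^sup>2 * (d $ i * d $ j) + ?S $ i $ j) \<partial>lborel) / sqrt (pi / 2)"
    using sn_mixture_integral(2)[OF R diag d p[unfolded p_def] _ int2[unfolded p_def]]
    by (simp add: p_def power2_eq_square ac_simps)
  also have "\<dots> = (\<integral>u. (half_normal_weight u * u\<^sup>2) * (d $ i * d $ j) + half_normal_weight u * ?S $ i $ j \<partial>lborel) / sqrt (pi / 2)"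
    by (simp only: distrib_left mult.assoc)
  also have "\<dots> = d $ i * d $ j + ?S $ i $ j"
  proof -
    have "(\<integral>u. (half_normal_weight u * u\<^sup>2) * a + half_normal_weight u * b \<partial>lborel) / sqrt (pi / 2) = a + b" for a b
      using hn by (simp add: add_divide_distrib)
    then show ?thesis .
  qed
  finally show "(\<integral>z. p z * (z $ i * z $ j) \<partial>lborel) = R $ i $ j"
    by (simp add: outer_square_def)
qed

lemma dcx_fun_translate: "dcx_fun g \<Longrightarrow> dcx_fun (\<lambda>w. g (v + w))"
  unfolding dcx_fun_def by (simp add: add.assoc[symmetric])

text \<open>A common d means common weights and common shifts u d, so the comparison is made for
  almost every u separately; the conditional covariances differ by \<open>R' - R\<close>.\<close>

theorem sn_expectation_mono:
  fixes R R' :: "real^'m^'m" and d :: "real^'m" and g :: "real^'m \<Rightarrow> real"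
  defines "p \<equiv> sn_density 0 R (sn_alpha R d)" and "p' \<equiv> sn_density 0 R' (sn_alpha R' d)"
  assumes R: "pos_def R" "\<And>i. R $ i $ i = 1" "d \<bullet> (matrix_inv R *v d) < 1"
    and R': "pos_def R'" "\<And>i. R' $ i $ i = 1" "d \<bullet> (matrix_inv R' *v d) < 1"
    and p: "integrable lborel p" "(\<integral>z. p z \<partial>lborel) = 1"
    and p': "integrable lborel p'" "(\<integral>z. p' z \<partial>lborel) = 1"
    and le: "R \<le> R'" and g: "dcx_fun g" and meas [measurable]: "g \<in> borel_measurable borel"
    and int: "integrable lborel (\<lambda>z. p z * g z)" "integrable lborel (\<lambda>z. p' z * g z)"
  shows "(\<integral>z. p z * g z \<partial>lborel) \<le> (\<integral>z. p' z * g z \<partial>lborel)"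
proof -
  note mix = sn_mixture_integral[OF R p[unfolded p_def] _ int(1)[unfolded p_def]]
  note mix' = sn_mixture_integral[OF R' p'[unfolded p'_def] _ int(2)[unfolded p'_def]]
  let ?S = "R - outer_square d" and ?S' = "R' - outer_square d"
  have le': "?S \<le> ?S'"
    using le by (simp add: less_eq_vec_def)
  have "AE u in lborel. half_normal_weight u * gauss_mean ?S (u *\<^sub>R d) g \<le> half_normal_weight u * gauss_mean ?S' (u *\<^sub>R d) g"
    using mix(3)[OF meas] mix'(3)[OF meas]
  proof eventually_elim
    case (elim u)
    show ?case
    proof (cases "half_normal_weight u = 0")
      case False
      then have "gauss_mean ?S (u *\<^sub>R d) g \<le> gauss_mean ?S' (u *\<^sub>R d) g"
        unfolding gauss_mean_def using elim
        by (intro gauss_expectation_mono pos_def_downdate R R' le' dcx_fun_translate g) auto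
      then show ?thesis by (intro mult_left_mono) auto
    qed simp
  qed
  then have "(\<integral>u. half_normal_weight u * gauss_mean ?S (u *\<^sub>R d) g \<partial>lborel) \<le>
      (\<integral>u. half_normal_weight u * gauss_mean ?S' (u *\<^sub>R d) g \<partial>lborel)"
    by (intro integral_mono_AE mix(1) mix'(1)) auto
  then show ?thesis
    unfolding p_def p'_def by (simp add: mix(2) mix'(2) divide_right_mono)
qed

section \<open>Matrix variate skew-normal distributions\<close>

lemma pos_def_diag:
  fixes A :: "real^'m^'m"
  assumes "pos_def A"
  shows "0 < A $ i $ i"
  using pos_def_pos[OF assms, of "axis i 1"]
  by (simp add: axis_eq_0_iff inner_axis' matrix_vector_mul_component inner_axis)

lemma corr_matrix_diag:
  fixes \<Omega> :: "real^'m^'m"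
  assumes pos: "\<And>i. 0 < \<Omega> $ i $ i"
  shows "corr_matrix \<Omega> $ i $ i = 1"
proof -
  define s :: "real^'m^'m" where "s = (\<chi> i j. if i = j then 1 / sqrt (\<Omega> $ i $ i) else 0)"
  have "scale_diag \<Omega> ** s = mat 1"
  proof -
    have "(if i = k then sqrt (\<Omega> $ i $ i) else 0) * (if k = j then 1 / sqrt (\<Omega> $ k $ k) else 0) =
        (if k = i then (if i = j then 1 else 0) else (0::real))" for i j k
      using pos[of i] by auto
    then show ?thesis
      by (simp add: scale_diag_def s_def matrix_matrix_mult_def mat_def vec_eq_iff)
  qed
  then have "matrix_inv (scale_diag \<Omega>) = s"
    by (rule matrix_inv_unique)
  moreover have left: "(s ** A) $ i $ j = A $ i $ j / sqrt (\<Omega> $ i $ i)" for A :: "real^'m^'m" and i j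
  proof -
    have "(if i = k then 1 / sqrt (\<Omega> $ i $ i) else 0) * A $ k $ j =
        (if k = i then A $ i $ j / sqrt (\<Omega> $ i $ i) else 0)" for k
      by auto
    then show ?thesis by (simp add: s_def matrix_matrix_mult_def)
  qed
  moreover have right: "(A ** s) $ i $ j = A $ i $ j / sqrt (\<Omega> $ j $ j)" for A :: "real^'m^'m" and i j
  proof -
    have "A $ i $ k * (if k = j then 1 / sqrt (\<Omega> $ k $ k) else 0) =
        (if k = j then A $ i $ j / sqrt (\<Omega> $ j $ j) else 0)" for k
      by auto
    then show ?thesis by (simp add: s_def matrix_matrix_mult_def)
  qed
  ultimately show ?thesis
    using pos[of i] by (simp add: corr_matrix_def)
qed

lemma corr_matrix_kronecker_diag:
  assumes "pos_def V" "pos_def S"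
  shows "corr_matrix (kronecker V S) $ i $ i = 1"
  by (rule corr_matrix_diag) (simp add: kronecker_def pos_def_diag assms)

section \<open>Stacked vectors and test functions on matrices\<close>

definition vec_unstack :: "real^('p \<times> 'n) \<Rightarrow> real^'p^'n" where
  "vec_unstack z = (\<chi> i j. z $ (j, i))"

lemma vec_unstack_stack [simp]: "vec_unstack (vec_stack A) = A"
  by (simp add: vec_unstack_def vec_stack_def vec_eq_iff)

lemma vec_stack_0 [simp]: "vec_stack 0 = 0"
  by (simp add: vec_stack_def vec_eq_iff)

lemma borel_measurable_vec_unstack [measurable]: "vec_unstack \<in> borel_measurable borel"
  unfolding vec_unstack_def[abs_def]
  by (intro borel_measurable_continuous_onI continuous_intros)

text \<open>Pairs carry the column index first, matrix entries the row index first.\<close>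

lemma vec_unstack_add_axis:
  "vec_unstack (x + axis (j, i) e) = vec_unstack x + e *\<^sub>R unit_matrix i j"
  by (auto simp: vec_unstack_def unit_matrix_def vec_eq_iff axis_def)

lemma directionally_convex_dcx_fun:
  fixes f :: "real^'p^'n \<Rightarrow> real"
  assumes "directionally_convex f"
  shows "dcx_fun (\<lambda>z. f (vec_unstack z))"
proof (rule dcx_funI)
  fix x :: "real^('p \<times> 'n)" and a b :: "'p \<times> 'n" and e d :: real
  assume "0 < e" "0 < d"
  obtain i j k l where ab: "a = (i, k)" "b = (j, l)" by (cases a, cases b) auto
  have "0 \<le> diff_op l j d (diff_op k i e f) (vec_unstack x)"
    using assms \<open>0 < e\<close> \<open>0 < d\<close> unfolding directionally_convex_def by blast
  then show "f (vec_unstack (x + axis a e)) + f (vec_unstack (x + axis b d)) \<le>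
      f (vec_unstack (x + axis a e + axis b d)) + f (vec_unstack x)"
    unfolding ab vec_unstack_add_axis diff_op_def by (simp add: ac_simps)
qed

lemma directionally_convex_linear:
  fixes a :: "real^'p^'n \<Rightarrow> real"
  assumes "linear a"
  shows "directionally_convex a"
  by (simp add: directionally_convex_def diff_op_def linear_add[OF assms])

text \<open>The second difference of a product of linear functions does not depend on X: only the
  two cross terms survive.\<close>

lemma directionally_convex_mult:
  fixes a b :: "real^'p^'n \<Rightarrow> real"
  assumes a: "linear a" "\<And>i j. 0 \<le> a (unit_matrix i j)"
    and b: "linear b" "\<And>i j. 0 \<le> b (unit_matrix i j)"
  shows "directionally_convex (\<lambda>X. a X * b X)"
  unfolding directionally_convex_def
proof (intro allI impI)
  fix X k l i j and e d :: real
  assume "0 < e \<and> 0 < d"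
  then have "0 \<le> e * d * (a (unit_matrix k i) * b (unit_matrix l j) + a (unit_matrix l j) * b (unit_matrix k i))"
    using a(2) b(2) by (intro mult_nonneg_nonneg add_nonneg_nonneg) auto
  also have "\<dots> = diff_op k i e (diff_op l j d (\<lambda>X. a X * b X)) X"
    by (simp add: diff_op_def linear_add[OF a(1)] linear_add[OF b(1)] linear_cmul[OF a(1)]
        linear_cmul[OF b(1)] algebra_simps)
  finally show "0 \<le> diff_op k i e (diff_op l j d (\<lambda>X. a X * b X)) X" .
qed

lemma linear_entry: "linear (\<lambda>X::real^'p^'n. X $ i $ j)"
  by (rule linearI) auto

text \<open>Moves expectations of matrix functions to integrals over stacked vectors. The constant 1
  as integrand shows that p has mass 1, which the mixture representation relies on.\<close>

lemma matrix_skew_normal_star_law: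
  fixes X :: "'a \<Rightarrow> real^'p^'n" and R :: "real^('p \<times> 'n)^('p \<times> 'n)" and d :: "real^('p \<times> 'n)"
  defines "p \<equiv> sn_density 0 R (sn_alpha R d)"
  assumes "prob_space M" and X: "matrix_skew_normal_star M X 0 R d"
  shows "pos_def R" "d \<bullet> (matrix_inv R *v d) < 1"
    "integrable lborel p" "(\<integral>z. p z \<partial>lborel) = 1"
    "f \<in> borel_measurable borel \<Longrightarrow>
      integrable M (\<lambda>x. f (X x)) \<longleftrightarrow> integrable lborel (\<lambda>z. p z * f (vec_unstack z))"
    "f \<in> borel_measurable borel \<Longrightarrow> (LINT x|M. f (X x)) = (\<integral>z. p z * f (vec_unstack z) \<partial>lborel)"
proof -
  interpret prob_space M by fact
  have D: "distributed M lborel (\<lambda>x. vec_stack (X x)) (\<lambda>z. ennreal (p z))"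
    and "pos_def R" "sn_admissible R d"
    using X unfolding matrix_skew_normal_star_def matrix_skew_normal_def skew_normal_def p_def by auto
  then show "pos_def R" "d \<bullet> (matrix_inv R *v d) < 1"
    by (simp_all add: sn_admissible_def)
  have p0: "0 \<le> p z" for z
    by (simp add: p_def sn_density_bounds)
  have int: "integrable lborel (\<lambda>z. p z * g z) \<longleftrightarrow> integrable M (\<lambda>x. g (vec_stack (X x)))"
    and eq: "(\<integral>z. p z * g z \<partial>lborel) = (LINT x|M. g (vec_stack (X x)))"
    if "g \<in> borel_measurable borel" for g :: "real^('p \<times> 'n) \<Rightarrow> real"
    using distributed_integrable[OF D, of g] distributed_integral[OF D, of g] that p0 by auto
  show "integrable lborel p" "(\<integral>z. p z \<partial>lborel) = 1"
    using int[of "\<lambda>_. 1"] eq[of "\<lambda>_. 1"] by (simp_all add: prob_space)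
  assume [measurable]: "f \<in> borel_measurable borel"
  have "(\<lambda>z. f (vec_unstack z)) \<in> borel_measurable borel" by measurable
  from int[OF this] eq[OF this]
  show "integrable M (\<lambda>x. f (X x)) \<longleftrightarrow> integrable lborel (\<lambda>z. p z * f (vec_unstack z))"
    "(LINT x|M. f (X x)) = (\<integral>z. p z * f (vec_unstack z) \<partial>lborel)"
    by simp_all
qed

lemma matrix_skew_normal_star_moments:
  fixes X :: "'a \<Rightarrow> real^'p^'n" and R :: "real^('p \<times> 'n)^('p \<times> 'n)" and d :: "real^('p \<times> 'n)"
  assumes M: "prob_space M" and X: "matrix_skew_normal_star M X 0 R d" and diag: "\<And>i. R $ i $ i = 1"
  shows "integrable M (\<lambda>x. X x $ i $ j)" "(LINT x|M. X x $ i $ j) = d $ (j, i) / sqrt (pi / 2)"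
    "integrable M (\<lambda>x. X x $ i $ j * X x $ k $ l)" "(LINT x|M. X x $ i $ j * X x $ k $ l) = R $ (j, i) $ (l, k)"
proof -
  note law = matrix_skew_normal_star_law[OF M X]
  note mom = sn_moments[OF law(1) diag law(2-4)]
  have 1: "(\<lambda>X::real^'p^'n. X $ i $ j) \<in> borel_measurable borel"
    and 2: "(\<lambda>X::real^'p^'n. X $ i $ j * X $ k $ l) \<in> borel_measurable borel"
    by (intro borel_measurable_continuous_onI continuous_intros)+
  show "integrable M (\<lambda>x. X x $ i $ j)" "(LINT x|M. X x $ i $ j) = d $ (j, i) / sqrt (pi / 2)"
    using law(5,6)[OF 1] mom(1,2)[of "(j, i)"] by (simp_all add: vec_unstack_def)
  show "integrable M (\<lambda>x. X x $ i $ j * X x $ k $ l)" "(LINT x|M. X x $ i $ j * X x $ k $ l) = R $ (j, i) $ (l, k)"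
    using law(5,6)[OF 2] mom(3,4)[of "(j, i)" "(l, k)"] by (simp_all add: vec_unstack_def)
qed

theorem theorem5p4:
  fixes M :: "'a measure" and N :: "'b measure"
    and X\<^sub>0 :: "'a \<Rightarrow> real^'p^'n" and Y\<^sub>0 :: "'b \<Rightarrow> real^'p^'n"
    and V V' :: "real^'p^'p" and S S' :: "real^'n^'n"
    and \<Omega> \<Omega>' :: "real^('p \<times> 'n)^('p \<times> 'n)"
    and \<delta> \<delta>' :: "real^('p \<times> 'n)"
  assumes "prob_space M" and "prob_space N"
    and "pos_def V" and "pos_def V'" and "pos_def S" and "pos_def S'"
    and "\<Omega> = kronecker V S" and "\<Omega>' = kronecker V' S'"
    and "matrix_skew_normal_star M X\<^sub>0 0 (corr_matrix \<Omega>) \<delta>"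
    and "matrix_skew_normal_star N Y\<^sub>0 0 (corr_matrix \<Omega>') \<delta>'"
  shows "dcx_le M X\<^sub>0 N Y\<^sub>0 \<longleftrightarrow> \<delta> = \<delta>' \<and> corr_matrix \<Omega>' - corr_matrix \<Omega> \<ge> 0"
proof
  let ?R = "corr_matrix \<Omega>" and ?R' = "corr_matrix \<Omega>'"
  have diag: "?R $ i $ i = 1" "?R' $ i $ i = 1" for i
    using assms(3-8) by (simp_all add: corr_matrix_kronecker_diag)
  note lawX = matrix_skew_normal_star_law[OF assms(1,9)]
    and lawY = matrix_skew_normal_star_law[OF assms(2,10)]
  note momX = matrix_skew_normal_star_moments[OF assms(1,9) diag(1)]
    and momY = matrix_skew_normal_star_moments[OF assms(2,10) diag(2)]
  {
    assume "dcx_le M X\<^sub>0 N Y\<^sub>0"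
    then have le: "(LINT x|M. f (X\<^sub>0 x)) \<le> (LINT y|N. f (Y\<^sub>0 y))"
      if "directionally_convex f" "f \<in> borel_measurable borel"
        "integrable M (\<lambda>x. f (X\<^sub>0 x))" "integrable N (\<lambda>y. f (Y\<^sub>0 y))" for f
      using that unfolding dcx_le_def by blast
    have "\<delta> $ a = \<delta>' $ a" for a
    proof -
      obtain j i where a: "a = (j, i)" by (cases a)
      have meas: "(\<lambda>X::real^'p^'n. X $ i $ j) \<in> borel_measurable borel"
        "(\<lambda>X::real^'p^'n. - (X $ i $ j)) \<in> borel_measurable borel"
        by (intro borel_measurable_continuous_onI continuous_intros)+
      have "\<delta> $ (j, i) / sqrt (pi / 2) \<le> \<delta>' $ (j, i) / sqrt (pi / 2)"
        using le[OF directionally_convex_linear[OF linear_entry[of i j]] meas(1)]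
        by (simp only: momX momY)
      \<comment> \<open>Second differences of linear functions vanish, so the negated entry is a
        test function too and gives the reverse inequality of means.\<close>
      moreover have "- (\<delta> $ (j, i) / sqrt (pi / 2)) \<le> - (\<delta>' $ (j, i) / sqrt (pi / 2))"
        using le[OF directionally_convex_linear[OF linear_compose_neg[OF linear_entry[of i j]]] meas(2)]
        by (simp only: momX momY integral_minus integrable_minus)
      ultimately have "\<delta> $ (j, i) / sqrt (pi / 2) = \<delta>' $ (j, i) / sqrt (pi / 2)"
        by simp
      then show ?thesis by (simp add: a)
    qed
    moreover have "?R $ a $ b \<le> ?R' $ a $ b" for a b
    proof -
      obtain j i l k where ab: "a = (j, i)" "b = (l, k)" by (cases a, cases b)
      \<comment> \<open>An entry is 0 or 1 on each unit matrix, so products of entries qualify,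
        squares included; their expectations are the correlation entries.\<close>
      have "directionally_convex (\<lambda>X::real^'p^'n. X $ i $ j * X $ k $ l)"
        by (rule directionally_convex_mult[OF linear_entry _ linear_entry]) (auto simp: unit_matrix_def axis_def)
      moreover have "(\<lambda>X::real^'p^'n. X $ i $ j * X $ k $ l) \<in> borel_measurable borel"
        by (intro borel_measurable_continuous_onI continuous_intros)
      ultimately show ?thesis
        using le[of "\<lambda>X. X $ i $ j * X $ k $ l"] by (simp only: momX momY ab)
    qed
    ultimately show "\<delta> = \<delta>' \<and> ?R' - ?R \<ge> 0"
      by (simp add: vec_eq_iff less_eq_vec_def)
  }
  {
    assume "\<delta> = \<delta>' \<and> ?R' - ?R \<ge> 0"
    then have \<delta>: "\<delta>' = \<delta>" and R: "?R \<le> ?R'"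
      by (auto simp: less_eq_vec_def)
    show "dcx_le M X\<^sub>0 N Y\<^sub>0"
      unfolding dcx_le_def
    proof (intro allI impI, elim conjE)
      fix f :: "real^'p^'n \<Rightarrow> real"
      assume f: "directionally_convex f" and [measurable]: "f \<in> borel_measurable borel"
        and int: "integrable M (\<lambda>x. f (X\<^sub>0 x))" "integrable N (\<lambda>y. f (Y\<^sub>0 y))"
      show "(LINT x|M. f (X\<^sub>0 x)) \<le> (LINT y|N. f (Y\<^sub>0 y))"
        using sn_expectation_mono[OF lawX(1) diag(1) lawX(2) lawY(1) diag(2) lawY(2)[unfolded \<delta>] lawX(3,4)
            lawY(3,4)[unfolded \<delta>] R directionally_convex_dcx_fun[OF f]] int
        by (simp add: lawX(5,6) lawY(5,6) \<delta>)
    qed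
  }
qed

end
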